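(* Let $\mathcal{A}=\{A_1,\dots,A_k\}$ be an affine subspace arrangement in $\mathbb{R}^n$ and let $\mathcal{V}$ be its Vassiliev diagram. Then the one-point compactification $\mathrm{hocolim}(\mathcal{V})\cup\{\infty\}$ is homeomorphic to $\widehat V(\mathcal{A})$, the one-point compactification of Vassiliev's geometric resolution $V(\mathcal{A})$ of $\mathcal{A}$.
   Context: An affine subspace arrangement is a finite collection $\mathcal{A}=\{A_1,\dots,A_k\}$ of affine subspaces of $\mathbb{R}^n$ such that $A_i\subseteq A_j$ implies $A_i=A_j$. Its intersection semilattice $\mathcal{L}(\mathcal{A})$ is the set of all nonempty intersections of the $A_i$'s ordered by reverse inclusion; $a_i\in\mathcal{L}(\mathcal{A})$ denotes the element corresponding to $A_i$ (these are the minimal elements). $\mathcal{U}(\mathcal{A})=\bigcup_i A_i$. The nerve complex $\mathcal{N}(\mathcal{L}(\mathcal{A}))$ is the simplicial complex on vertex set $\{a_1,\dots,a_k\}$ whose simplices are the nonempty sets $\{a_{i_1},\dots,a_{i_m}\}$ having a join in $\mathcal{L}(\mathcal{A})$, i.e. with $A_{i_1}\cap\dots\cap A_{i_m}\neq\emptyset$. Its face poset $\mathcal{F}(\mathcal{N}(\mathcal{L}(\mathcal{A})))$ is the poset of these simplices ordered by inclusion. The Vassiliev diagram $\mathcal{V}$ is the functor on this face poset with $\mathcal{V}(\{a_{i_1},\dots,a_{i_m}\})=A_{i_1}\cap\dots\cap A_{i_m}$ and, for $\{j_1,\dots,j_q\}\subseteq\{i_1,\dots,i_m\}$, the map $\mathcal{V}(\{a_{i_1},\dots,a_{i_m}\}\to\{a_{j_1},\dots,a_{j_q}\})$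 being the inclusion $A_{i_1}\cap\dots\cap A_{i_m}\hookrightarrow A_{j_1}\cap\dots\cap A_{j_q}$. Homotopy colimit: a poset is a category with a morphism $x\to y$ whenever $x\geq y$; a diagram $\mathcal{D}$ over a poset $P$ is a functor $P\to\mathbf{Top}$. $\Delta(Q)$ is the geometric realization of the order complex of a poset $Q$ (simplices = nonempty chains); $P_{\leq x}=\{y: y\leq x\}$; $I(y\hookrightarrow x):\Delta(P_{\leq y})\hookrightarrow\Delta(P_{\leq x})$ the inclusion. $\mathrm{Bd}(P)$ is the poset of nonempty chains $x_1>\dots>x_t$ of $P$ ordered by inclusion. $\mathrm{hocolim}(\mathcal{D})$ is the colimit in $\mathbf{Top}$ of the functor on $\mathrm{Bd}(P)$ sending $(x_1>\dots>x_t)$ to $\Delta(P_{\leq x_t})\times\mathcal{D}(x_1)$ and the morphism to a subchain $(x_{i_1}>\dots>x_{i_p})$ ($i_1<\dots<i_p$) to $I(x_t\hookrightarrow x_{i_p})\times\mathcal{D}(x_1\to x_{i_1})$. Geometric resolution: for $N$ large, choose injective affine embeddings $\varphi_i:A_i\to\mathbb{R}^N$ in generic position such that for every $x\in\mathcal{U}(\mathcal{A})$ the convex hull $V(x)$ of the points $\{\varphi_i(x): x\in A_i\}$ is a simplex with these points as its vertices, and $V(x)\cap V(y)=\emptyset$ for $x\neq y$ in $\mathcal{U}(\mathcal{A})$ (such choices exist). Then $V(\mathcal{A})=\bigcup_{x\in\mathcal{U}(\mathcal{A})}V(x)$ and $\widehat V(\mathcal{A})=V(\mathcal{A})\cup\{\infty\}$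 is its one-point compactification. *)

theory Defs
  imports "HOL-Analysis.Analysis"
begin

text \<open>
  A poset is a subset \<open>P\<close> of a type of class \<^class>\<open>order\<close>, regarded as a category with one
  morphism \<open>x \<rightarrow> y\<close> whenever \<open>x \<ge> y\<close>.  All objects of a diagram are topologies on a common
  type; \<open>mor D x y\<close> is relevant only on \<open>topspace (ob D x)\<close> and for \<open>y \<le> x\<close> in \<open>shape D\<close>.
\<close>

record ('p, 'x) diagram =
  shape :: "'p set"
  ob :: "'p \<Rightarrow> 'x topology"
  mor :: "'p \<Rightarrow> 'p \<Rightarrow> 'x \<Rightarrow> 'x"

definition functorial :: "('p::order, 'x) diagram \<Rightarrow> bool" where
  "functorial D \<longleftrightarrow>
     (\<forall>x\<in>shape D. \<forall>y\<in>shape D. y \<le> x \<longrightarrow> continuous_map (ob D x) (ob D y) (mor D x y)) \<and>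
     (\<forall>x\<in>shape D. \<forall>v\<in>topspace (ob D x). mor D x x v = v) \<and>
     (\<forall>x\<in>shape D. \<forall>y\<in>shape D. \<forall>z\<in>shape D. z \<le> y \<longrightarrow> y \<le> x \<longrightarrow>
        (\<forall>v\<in>topspace (ob D x). mor D x z v = mor D y z (mor D x y v)))"

definition quotient_topology :: "'a topology \<Rightarrow> ('a \<times> 'a) set \<Rightarrow> 'a set topology" where
  "quotient_topology X R =
     topology (\<lambda>U. U \<subseteq> topspace X // R \<and> openin X {x \<in> topspace X. R `` {x} \<in> U})"

lemma openin_quotient_topology:
  "openin (quotient_topology X R) U \<longleftrightarrow>
     U \<subseteq> topspace X // R \<and> openin X {x \<in> topspace X. R `` {x} \<in> U}"
proof -
  have "istopology (\<lambda>U. U \<subseteq> topspace X // R \<and> openin X {x \<in> topspace X. R `` {x} \<in> U})"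
    unfolding istopology_def
  proof (intro conjI allI impI)
    fix S T
    assume "S \<subseteq> topspace X // R \<and> openin X {x \<in> topspace X. R `` {x} \<in> S}"
      and "T \<subseteq> topspace X // R \<and> openin X {x \<in> topspace X. R `` {x} \<in> T}"
    then have "openin X ({x \<in> topspace X. R `` {x} \<in> S} \<inter> {x \<in> topspace X. R `` {x} \<in> T})"
      by blast
    moreover have "{x \<in> topspace X. R `` {x} \<in> S} \<inter> {x \<in> topspace X. R `` {x} \<in> T}
        = {x \<in> topspace X. R `` {x} \<in> S \<inter> T}"
      by blast
    ultimately show "openin X {x \<in> topspace X. R `` {x} \<in> S \<inter> T}"
      by simp
  next
    fix \<K>
    assume "\<forall>K\<in>\<K>. K \<subseteq> topspace X // R \<and> openin X {x \<in> topspace X. R `` {x} \<in> K}"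
    then have "openin X (\<Union>K\<in>\<K>. {x \<in> topspace X. R `` {x} \<in> K})"
      by blast
    moreover have "(\<Union>K\<in>\<K>. {x \<in> topspace X. R `` {x} \<in> K}) = {x \<in> topspace X. R `` {x} \<in> \<Union>\<K>}"
      by blast
    ultimately show "openin X {x \<in> topspace X. R `` {x} \<in> \<Union>\<K>}"
      by simp
  qed blast+
  then show ?thesis
    unfolding quotient_topology_def by simp
qed

lemma topspace_quotient_topology: "topspace (quotient_topology X R) = topspace X // R"
proof
  have "{x \<in> topspace X. R `` {x} \<in> topspace X // R} = topspace X"
    by (auto intro: quotientI)
  then have "openin (quotient_topology X R) (topspace X // R)"
    by (simp add: openin_quotient_topology)
  then show "topspace X // R \<subseteq> topspace (quotient_topology X R)"
    by (rule openin_subset)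
qed (metis openin_quotient_topology openin_topspace)

lemma quotient_map_quotient_topology:
  "quotient_map X (quotient_topology X R) (\<lambda>x. R `` {x})"
  by (auto simp: quotient_map_def topspace_quotient_topology openin_quotient_topology quotient_def)

inductive glue :: "('p::order, 'x) diagram \<Rightarrow> 'p \<times> 'x \<Rightarrow> 'p \<times> 'x \<Rightarrow> bool" for D where
  "x \<in> shape D \<Longrightarrow> y \<in> shape D \<Longrightarrow> y \<le> x \<Longrightarrow> v \<in> topspace (ob D x) \<Longrightarrow>
     glue D (x, v) (y, mor D x y v)"

text \<open>The colimit in \<open>Top\<close>: the disjoint union of the objects modulo the equivalence relation
  generated by \<open>v \<sim> mor D x y v\<close>.\<close>

definition colim :: "('p::order, 'x) diagram \<Rightarrow> ('p \<times> 'x) set topology" where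
  "colim D =
     (let X = sum_topology (ob D) (shape D)
      in quotient_topology X
           {(a, b). a \<in> topspace X \<and> b \<in> topspace X \<and> equivclp (glue D) a b})"

text \<open>Nonempty finite chains.  Ordered by inclusion this set is also the poset \<open>Bd(P)\<close>.\<close>

definition order_complex :: "'p::order set \<Rightarrow> 'p set set" where
  "order_complex P =
     {c. finite c \<and> c \<noteq> {} \<and> c \<subseteq> P \<and> Complete_Partial_Order.chain (\<le>) c}"

text \<open>Points of the realization of an abstract simplicial complex are given by barycentric
  coordinates, extended by \<open>0\<close> to the whole vertex type, so that the realization of a
  subcomplex is literally a subset.  The topology is the weak topology determined by the
  closed simplices.\<close>

definition closed_face :: "'v set \<Rightarrow> ('v \<Rightarrow> real) set" where
  "closed_face s = {p. (\<forall>v. 0 \<le> p v) \<and> (\<forall>v. v \<notin> s \<longrightarrow> p v = 0) \<and> sum p s = 1}"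

definition geometric_realization :: "'v set set \<Rightarrow> ('v \<Rightarrow> real) topology" where
  "geometric_realization K =
     topology (\<lambda>U. U \<subseteq> (\<Union>s\<in>K. closed_face s) \<and>
       (\<forall>s\<in>K. openin (top_of_set (closed_face s)) (U \<inter> closed_face s)))"

lemma openin_geometric_realization:
  "openin (geometric_realization K) U \<longleftrightarrow>
     U \<subseteq> (\<Union>s\<in>K. closed_face s) \<and>
     (\<forall>s\<in>K. openin (top_of_set (closed_face s)) (U \<inter> closed_face s))"
proof -
  have "istopology (\<lambda>U. U \<subseteq> (\<Union>s\<in>K. closed_face s) \<and>
       (\<forall>s\<in>K. openin (top_of_set (closed_face s)) (U \<inter> closed_face s)))"
    unfolding istopology_def
  proof (intro conjI allI impI ballI)
    fix S T s
    assume "S \<subseteq> (\<Union>s\<in>K. closed_face s) \<and>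
        (\<forall>s\<in>K. openin (top_of_set (closed_face s)) (S \<inter> closed_face s))"
      and "T \<subseteq> (\<Union>s\<in>K. closed_face s) \<and>
        (\<forall>s\<in>K. openin (top_of_set (closed_face s)) (T \<inter> closed_face s))"
      and "s \<in> K"
    then have "openin (top_of_set (closed_face s)) ((S \<inter> closed_face s) \<inter> (T \<inter> closed_face s))"
      by (blast intro: openin_Int)
    moreover have "(S \<inter> closed_face s) \<inter> (T \<inter> closed_face s) = S \<inter> T \<inter> closed_face s"
      by blast
    ultimately show "openin (top_of_set (closed_face s)) (S \<inter> T \<inter> closed_face s)"
      by simp
  next
    fix \<K> s
    assume "\<forall>U\<in>\<K>. U \<subseteq> (\<Union>s\<in>K. closed_face s) \<and>
        (\<forall>s\<in>K. openin (top_of_set (closed_face s)) (U \<inter> closed_face s))"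
      and "s \<in> K"
    then have "openin (top_of_set (closed_face s)) (\<Union>U\<in>\<K>. U \<inter> closed_face s)"
      by (intro openin_Union) auto
    moreover have "(\<Union>U\<in>\<K>. U \<inter> closed_face s) = \<Union>\<K> \<inter> closed_face s"
      by blast
    ultimately show "openin (top_of_set (closed_face s)) (\<Union>\<K> \<inter> closed_face s)"
      by simp
  qed blast+
  then show ?thesis
    unfolding geometric_realization_def by simp
qed

lemma topspace_geometric_realization:
  "topspace (geometric_realization K) = (\<Union>s\<in>K. closed_face s)"
proof
  have "(\<Union>s\<in>K. closed_face s) \<inter> closed_face t = closed_face t" if "t \<in> K" for t
    using that by blast
  then have "openin (geometric_realization K) (\<Union>s\<in>K. closed_face s)"
    by (simp add: openin_geometric_realization)
  then show "(\<Union>s\<in>K. closed_face s) \<subseteq> topspace (geometric_realization K)"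
    by (rule openin_subset)
qed (metis openin_geometric_realization openin_topspace)

text \<open>For a chain \<open>c = (x\<^sub>1 > \<dots> > x\<^sub>t)\<close>, \<open>x\<^sub>1\<close> is the greatest and \<open>x\<^sub>t\<close> the least element.  The
  inclusion of realizations is the identity on coordinate functions.\<close>

definition hocolim_diagram ::
    "('p::order, 'x) diagram \<Rightarrow> ('p set, ('p \<Rightarrow> real) \<times> 'x) diagram" where
  "hocolim_diagram D =
     \<lparr>shape = order_complex (shape D),
      ob = (\<lambda>c. prod_topology
                  (geometric_realization
                     (order_complex {y \<in> shape D. y \<le> (LEAST x. x \<in> c)}))
                  (ob D (GREATEST x. x \<in> c))),
      mor = (\<lambda>c c'. map_prod id (mor D (GREATEST x. x \<in> c) (GREATEST x. x \<in> c')))\<rparr>"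

definition hocolim ::
    "('p::order, 'x) diagram \<Rightarrow> ('p set \<times> (('p \<Rightarrow> real) \<times> 'x)) set topology" where
  "hocolim D = colim (hocolim_diagram D)"

definition affine_arrangement :: "(real^'n) set set \<Rightarrow> bool" where
  "affine_arrangement \<A> \<longleftrightarrow>
     finite \<A> \<and> (\<forall>A\<in>\<A>. affine A \<and> A \<noteq> {}) \<and> (\<forall>A\<in>\<A>. \<forall>B\<in>\<A>. A \<subseteq> B \<longrightarrow> A = B)"

definition intersection_semilattice :: "(real^'n) set set \<Rightarrow> (real^'n) set set" where
  "intersection_semilattice \<A> = {\<Inter>\<B> | \<B>. \<B> \<subseteq> \<A> \<and> \<B> \<noteq> {} \<and> \<Inter>\<B> \<noteq> {}}"

text \<open>The order on the intersection semilattice is reverse inclusion, hence the element \<open>J\<close> below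
  is a least upper bound.\<close>

definition has_join :: "(real^'n) set set \<Rightarrow> (real^'n) set set \<Rightarrow> bool" where
  "has_join L S \<longleftrightarrow>
     (\<exists>J\<in>L. (\<forall>A\<in>S. J \<subseteq> A) \<and> (\<forall>X\<in>L. (\<forall>A\<in>S. X \<subseteq> A) \<longrightarrow> X \<subseteq> J))"

text \<open>The vertex \<open>a\<^sub>i\<close> is the subspace \<open>A\<^sub>i\<close> itself, and the face poset of the nerve is the set of
  its simplices with inclusion, the order of the type \<^typ>\<open>(real^'n) set set\<close>.\<close>

definition nerve_complex :: "(real^'n) set set \<Rightarrow> (real^'n) set set set" where
  "nerve_complex \<A> = {S. S \<subseteq> \<A> \<and> S \<noteq> {} \<and> has_join (intersection_semilattice \<A>) S}"

definition vassiliev_diagram ::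
    "(real^'n) set set \<Rightarrow> ((real^'n) set set, real^'n) diagram" where
  "vassiliev_diagram \<A> =
     \<lparr>shape = nerve_complex \<A>, ob = (\<lambda>S. top_of_set (\<Inter>S)), mor = (\<lambda>S T x. x)\<rparr>"

lemma functorial_vassiliev_diagram: "functorial (vassiliev_diagram \<A>)"
  unfolding functorial_def vassiliev_diagram_def by (auto simp: continuous_map_in_subtopology)

definition affine_on :: "('a::real_vector) set \<Rightarrow> ('a \<Rightarrow> 'b::real_vector) \<Rightarrow> bool" where
  "affine_on A f \<longleftrightarrow>
     (\<forall>x\<in>A. \<forall>y\<in>A. \<forall>u v. u + v = 1 \<longrightarrow>
        f (u *\<^sub>R x + v *\<^sub>R y) = u *\<^sub>R f x + v *\<^sub>R f y)"

definition resolution_fibre ::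
    "(real^'n) set set \<Rightarrow> ((real^'n) set \<Rightarrow> real^'n \<Rightarrow> real^'m) \<Rightarrow> real^'n \<Rightarrow> (real^'m) set" where
  "resolution_fibre \<A> \<phi> x = convex hull {\<phi> A x | A. A \<in> \<A> \<and> x \<in> A}"

text \<open>The conditions on the embeddings \<open>\<phi> A\<close>, one for each \<open>A \<in> \<A>\<close>.  That the fibre over \<open>x\<close> is a
  simplex with vertices \<open>\<phi> A x\<close> means that these points are pairwise distinct for different
  \<open>A\<close> and affinely independent.\<close>

definition resolution_embeddings ::
    "(real^'n) set set \<Rightarrow> ((real^'n) set \<Rightarrow> real^'n \<Rightarrow> real^'m) \<Rightarrow> bool" where
  "resolution_embeddings \<A> \<phi> \<longleftrightarrow>
     (\<forall>A\<in>\<A>. affine_on A (\<phi> A) \<and> inj_on (\<phi> A) A) \<and>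
     (\<forall>x\<in>\<Union>\<A>. inj_on (\<lambda>A. \<phi> A x) {A \<in> \<A>. x \<in> A} \<and>
                \<not> affine_dependent {\<phi> A x | A. A \<in> \<A> \<and> x \<in> A}) \<and>
     (\<forall>x\<in>\<Union>\<A>. \<forall>y\<in>\<Union>\<A>. x \<noteq> y \<longrightarrow>
        resolution_fibre \<A> \<phi> x \<inter> resolution_fibre \<A> \<phi> y = {})"

definition geometric_resolution ::
    "(real^'n) set set \<Rightarrow> ((real^'n) set \<Rightarrow> real^'n \<Rightarrow> real^'m) \<Rightarrow> (real^'m) set" where
  "geometric_resolution \<A> \<phi> = (\<Union>x\<in>\<Union>\<A>. resolution_fibre \<A> \<phi> x)"

end

theory Submission
  imports Defs
begin

text \<open>
  A point of the homotopy colimit is a pair \<open>(p, x)\<close> in which \<open>p\<close> is a point of the barycentric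
  subdivision of the nerve and \<open>x\<close> lies in all subspaces of the simplex carrying \<open>p\<close>.  It is sent
  to \<open>\<Sum>A. t A *\<^sub>R \<phi> A x\<close>, where \<open>t\<close> are the barycentric coordinates of \<open>p\<close> in the nerve.  This is a
  bijection onto the resolution because the fibres \<open>V(x)\<close> are pairwise disjoint simplices.  On each
  of the finitely many cells the map is proper: for fixed \<open>p\<close> it is affine and injective in \<open>x\<close>, and
  \<open>p\<close> ranges over a compact set.  Hence the map is closed, so that already the spaces without the
  points at infinity are homeomorphic.
\<close>

subsection \<open>Barycentric subdivision\<close>

text \<open>Unlike in a geometric realization, the total weight is not required to be \<open>1\<close>: the inductions
  below peel off the largest member of the supporting chain.\<close>

definition chain_weight :: "'a set \<Rightarrow> ('a set \<Rightarrow> real) \<Rightarrow> bool" where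
  "chain_weight V p \<longleftrightarrow>
     (\<forall>S. 0 \<le> p S) \<and> Complete_Partial_Order.chain (\<le>) {S. p S \<noteq> 0} \<and> {S. p S \<noteq> 0} \<subseteq> Pow V - {{}}"

text \<open>The vertex \<open>S\<close> of the subdivision is the barycentre of the simplex
  \<open>S\<close>, so its weight is shared equally among the members of \<open>S\<close>.\<close>

definition bary :: "'a set \<Rightarrow> ('a set \<Rightarrow> real) \<Rightarrow> 'a \<Rightarrow> real" where
  "bary V p a = (\<Sum>S | S \<subseteq> V \<and> a \<in> S. p S / card S)"

lemma chain_weight_subset: "chain_weight V p \<Longrightarrow> p S \<noteq> 0 \<Longrightarrow> S \<subseteq> V"
  unfolding chain_weight_def by blast

lemma chain_weight_nonempty: "chain_weight V p \<Longrightarrow> p S \<noteq> 0 \<Longrightarrow> S \<noteq> {}"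
  unfolding chain_weight_def by blast

lemma bary_nonneg: "chain_weight V p \<Longrightarrow> 0 \<le> bary V p a"
  unfolding bary_def chain_weight_def by (intro sum_nonneg) auto

text \<open>Used to split off the largest member of a supporting chain, or to put it back.\<close>

lemma bary_upd:
  assumes "finite V" "T \<subseteq> V"
  shows "bary V (p(T := r)) a = bary V p a + (if a \<in> T then (r - p T) / card T else 0)"
proof -
  let ?F = "{S. S \<subseteq> V \<and> a \<in> S}"
  have fin: "finite ?F"
    using assms by simp
  have *: "(\<Sum>S\<in>?F. (p(T := r)) S / card S) = (\<Sum>S\<in>?F. p S / card S + (if S = T then (r - p T) / card T else 0))"
    by (intro sum.cong) (auto simp: field_simps add_divide_distrib[symmetric])
  show ?thesis
    unfolding bary_def * using assms fin by (simp add: sum.distrib)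
qed

text \<open>Each nonempty \<open>S\<close> hands out \<open>card S\<close> shares of size
  \<open>p S / card S\<close>. The empty set has no member to receive its weight, hence the
  condition \<open>p {} = 0\<close>.\<close>

lemma sum_bary:
  assumes "finite V" "p {} = 0"
  shows "(\<Sum>a\<in>V. bary V p a) = (\<Sum>S\<in>Pow V. p S)"
proof -
  have "(\<Sum>a\<in>V. bary V p a) = (\<Sum>a\<in>V. \<Sum>S\<in>Pow V. if a \<in> S then p S / card S else 0)"
    unfolding bary_def using assms by (simp add: sum.If_cases Int_def)
  also have "\<dots> = (\<Sum>S\<in>Pow V. \<Sum>a\<in>V. if a \<in> S then p S / card S else 0)"
    by (rule sum.swap)
  also have "\<dots> = (\<Sum>S\<in>Pow V. p S)"
  proof (rule sum.cong[OF refl])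
    fix S assume S: "S \<in> Pow V"
    then have "V \<inter> S = S" "finite S"
      using assms finite_subset by auto
    then show "(\<Sum>a\<in>V. if a \<in> S then p S / card S else 0) = p S"
      using assms by (cases "S = {}") (simp_all flip: sum.inter_restrict)
  qed
  finally show ?thesis .
qed

lemma chain_weight_top:
  assumes "finite V" "chain_weight V p" "p S \<noteq> 0"
  obtains T where "p T \<noteq> 0" "\<And>S. p S \<noteq> 0 \<Longrightarrow> S \<subseteq> T"
proof -
  have "finite {S. p S \<noteq> 0}"
    using assms by (auto simp: chain_weight_def intro: finite_subset[of _ "Pow V"])
  moreover have "{S. p S \<noteq> 0} \<noteq> {}"
    using assms(3) by blast
  ultimately obtain T where
    T: "T \<in> {S. p S \<noteq> 0}" "\<forall>S\<in>{S. p S \<noteq> 0}. T \<subseteq> S \<longrightarrow> T = S"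
    using finite_has_maximal by metis
  have "S \<subseteq> T" if "p S \<noteq> 0" for S
  proof -
    have "S \<subseteq> T \<or> T \<subseteq> S"
      using assms(2) T(1) that unfolding chain_weight_def chain_def by simp
    then show ?thesis
      using T(2) that by auto
  qed
  then show thesis
    using T(1) that by simp
qed

lemma chain_weight_remove: "chain_weight V p \<Longrightarrow> chain_weight V (p(T := 0))"
  unfolding chain_weight_def by (auto simp: chain_def split: if_splits)

text \<open>The summands are nonnegative, so they cannot cancel.\<close>

lemma bary_pos_iff:
  assumes "finite V" "chain_weight V p"
  shows "bary V p a \<noteq> 0 \<longleftrightarrow> (\<exists>S. p S \<noteq> 0 \<and> a \<in> S)"
proof -
  let ?F = "{S. S \<subseteq> V \<and> a \<in> S}"
  have nonneg: "0 \<le> p S / card S" for S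
    using assms(2) by (simp add: chain_weight_def)
  have "p S / card S = 0 \<longleftrightarrow> p S = 0" if "S \<in> ?F" for S
  proof -
    have "finite S"
      using that assms finite_subset by blast
    then show ?thesis
      using that by auto
  qed
  moreover have "bary V p a = 0 \<longleftrightarrow> (\<forall>S\<in>?F. p S / card S = 0)"
    unfolding bary_def by (rule sum_nonneg_eq_0_iff) (use assms nonneg in auto)
  moreover have "S \<subseteq> V" if "p S \<noteq> 0" for S
    using assms(2) that by (auto simp: chain_weight_def)
  ultimately show ?thesis
    by (metis (mono_tags, lifting) mem_Collect_eq)
qed

text \<open>The support of the coordinates is the union of the chain, which is its largest member.
  Thus the coordinates determine that member.\<close>

lemma bary_support:
  assumes "finite V" "chain_weight V p" "p T \<noteq> 0" "\<And>S. p S \<noteq> 0 \<Longrightarrow> S \<subseteq> T"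
  shows "{a. bary V p a \<noteq> 0} = T"
  using bary_pos_iff[OF assms(1,2)] assms(3,4) by blast

text \<open>The part of the chain strictly below \<open>T\<close> misses some vertex of \<open>T\<close>, and there only \<open>T\<close> itself
  contributes.\<close>

lemma bary_top:
  assumes V: "finite V" and p: "chain_weight V p"
    and T: "p T \<noteq> 0" "\<And>S. p S \<noteq> 0 \<Longrightarrow> S \<subseteq> T"
  shows "p T / card T = Min (bary V p ` T)"
proof -
  have TV: "T \<subseteq> V" "T \<noteq> {}"
    using p T by (auto simp: chain_weight_def)
  then have finT: "finite T"
    using V finite_subset by blast
  let ?q = "p(T := 0)"
  have q: "chain_weight V ?q"
    by (rule chain_weight_remove[OF p])
  have eq: "bary V p a = bary V ?q a + p T / card T" if "a \<in> T" for a
    using bary_upd[OF V TV(1), of p 0 a] that by (simp add: field_simps)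
  have "\<exists>a\<in>T. bary V ?q a = 0"
  proof (cases "\<exists>S. ?q S \<noteq> 0")
    case False
    then show ?thesis
      using TV bary_pos_iff[OF V q] by blast
  next
    case True
    then obtain U where U: "?q U \<noteq> 0" "\<And>S. ?q S \<noteq> 0 \<Longrightarrow> S \<subseteq> U"
      using chain_weight_top[OF V q] by blast
    then have "U \<subset> T"
      using T(2) by (auto split: if_splits)
    then obtain a where "a \<in> T" "a \<notin> U"
      by blast
    then show ?thesis
      using bary_support[OF V q U] by blast
  qed
  then obtain a where a: "a \<in> T" "bary V ?q a = 0"
    by blast
  show ?thesis
  proof (rule sym, rule Min_eqI)
    show "p T / card T \<le> y" if "y \<in> bary V p ` T" for y
      using that eq bary_nonneg[OF q] by fastforce
    have "p T / card T = bary V p a"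
      using a eq by simp
    then show "p T / card T \<in> bary V p ` T"
      using a(1) by blast
  qed (use finT in simp)
qed

text \<open>Induction on the length of the chain: the support of the coordinates recovers the
  largest member and \<open>bary_top\<close> its weight. Removing it on both sides leaves equal
  coordinates.\<close>

lemma bary_inj:
  assumes V: "finite V"
    and "chain_weight V p" "chain_weight V q" "bary V p = bary V q"
  shows "p = q"
  using assms(2-)
proof (induction n \<equiv> "card {S. p S \<noteq> 0}" arbitrary: p q rule: less_induct)
  case (less p q)
  note p = less.prems(1) and q = less.prems(2) and eq = less.prems(3)
  have supp: "(\<exists>S. p S \<noteq> 0 \<and> a \<in> S) \<longleftrightarrow> (\<exists>S. q S \<noteq> 0 \<and> a \<in> S)" for a
    by (simp only: bary_pos_iff[OF V p, symmetric] bary_pos_iff[OF V q, symmetric] eq)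
  show ?case
  proof (cases "\<exists>S. p S \<noteq> 0")
    case False
    have "q S = 0" for S
    proof (rule ccontr)
      assume "q S \<noteq> 0"
      moreover from this obtain a where "a \<in> S"
        using chain_weight_nonempty[OF q] by blast
      ultimately show False
        using supp False by blast
    qed
    with False show ?thesis
      by (simp add: fun_eq_iff)
  next
    case True
    then obtain T where T: "p T \<noteq> 0" "\<And>S. p S \<noteq> 0 \<Longrightarrow> S \<subseteq> T"
      using chain_weight_top[OF V p] by blast
    then obtain a where "a \<in> T"
      using chain_weight_nonempty[OF p T(1)] by blast
    then have "\<exists>S. q S \<noteq> 0"
      using supp T by blast
    then obtain U where U: "q U \<noteq> 0" "\<And>S. q S \<noteq> 0 \<Longrightarrow> S \<subseteq> U"
      using chain_weight_top[OF V q] by blast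
    have [simp]: "U = T"
      using bary_support[OF V p T] bary_support[OF V q U] eq by simp
    have TV: "T \<subseteq> V" "T \<noteq> {}"
      using p T by (auto simp: chain_weight_def)
    then have "card T \<noteq> 0"
      using finite_subset[OF TV(1) V] by simp
    moreover have "p T / card T = q T / card T"
      using bary_top[OF V p T] bary_top[OF V q U] eq by simp
    ultimately have pq: "p T = q T"
      by simp
    have "finite {S. p S \<noteq> 0}"
      using p V by (auto simp: chain_weight_def intro: finite_subset[of _ "Pow V"])
    then have "card {S. (p(T := 0)) S \<noteq> 0} < card {S. p S \<noteq> 0}"
      using T(1) by (intro psubset_card_mono) auto
    moreover have "bary V (p(T := 0)) = bary V (q(T := 0))"
      using eq pq by (simp add: fun_eq_iff bary_upd[OF V TV(1)])
    ultimately have "p(T := 0) = q(T := 0)"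
      using less.hyps chain_weight_remove p q by blast
    then show ?thesis
      using pq by (metis fun_upd_triv fun_upd_upd)
  qed
qed

text \<open>The support \<open>T\<close> of \<open>t\<close> becomes the largest member of the
  chain; subtracting the minimum of \<open>t\<close> on \<open>T\<close> shrinks the support, so
  induction applies. The last conclusion keeps the chain for the remainder below
  \<open>T\<close>.\<close>

lemma bary_surj:
  fixes t :: "'a \<Rightarrow> real"
  assumes V: "finite V"
  shows "(\<And>a. 0 \<le> t a) \<Longrightarrow> {a. t a \<noteq> 0} \<subseteq> V \<Longrightarrow>
    \<exists>p. chain_weight V p \<and> bary V p = t \<and> (\<forall>S. p S \<noteq> 0 \<longrightarrow> S \<subseteq> {a. t a \<noteq> 0})"
proof (induction "card {a. t a \<noteq> 0}" arbitrary: t rule: less_induct)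
  case less
  define T where "T = {a. t a \<noteq> 0}"
  have TV: "T \<subseteq> V" and finT: "finite T"
    using less.prems V finite_subset unfolding T_def by blast+
  show ?case
  proof (cases "T = {}")
    case True
    then have "t = (\<lambda>_. 0)"
      by (auto simp: T_def)
    then show ?thesis
      by (intro exI[of _ "\<lambda>_. 0"]) (auto simp: chain_weight_def chain_def bary_def)
  next
    case False
    define m where "m = Min (t ` T)"
    have "m \<in> t ` T"
      unfolding m_def using finT False by simp
    then obtain b where b: "b \<in> T" "t b = m"
      by blast
    have m: "m \<le> t a" if "a \<in> T" for a
      unfolding m_def using finT that by simp
    have "0 < m"
      using b less.prems(1)[of b] by (auto simp: T_def)
    define t' where "t' a = (if a \<in> T then t a - m else 0)" for a
    \<comment> \<open>The inclusion is strict because the minimiser \<open>b\<close> drops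
      out.\<close>
    have sub: "{a. t' a \<noteq> 0} \<subset> T"
      using b by (auto simp: t'_def)
    then have "card {a. t' a \<noteq> 0} < card {a. t a \<noteq> 0}"
      unfolding T_def[symmetric] using finT by (rule psubset_card_mono[rotated])
    moreover have "0 \<le> t' a" for a
      using m by (simp add: t'_def)
    moreover have "{a. t' a \<noteq> 0} \<subseteq> V"
      using sub TV by blast
    ultimately obtain p where p: "chain_weight V p" "bary V p = t'"
      "\<And>S. p S \<noteq> 0 \<Longrightarrow> S \<subseteq> {a. t' a \<noteq> 0}"
      using less.hyps[of t'] by blast
    have pT: "p T = 0"
      using p(3)[of T] sub by blast
    \<comment> \<open>This weight gives every member of \<open>T\<close> exactly the share
      \<open>m\<close> that was subtracted.\<close>
    let ?p = "p(T := m * card T)"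
    have "card T > 0"
      using False finT by (simp add: card_gt_0_iff)
    have psub: "S \<subseteq> T" if "p S \<noteq> 0" for S
      using p(3)[OF that] sub by blast
    have "chain_weight V ?p"
      unfolding chain_weight_def chain_def
    proof (intro conjI allI ballI)
      fix S U assume "S \<in> {S. ?p S \<noteq> 0}" "U \<in> {S. ?p S \<noteq> 0}"
      then have "S = T \<or> p S \<noteq> 0" "U = T \<or> p U \<noteq> 0"
        by (auto split: if_splits)
      then show "S \<subseteq> U \<or> U \<subseteq> S"
        using p(1) psub unfolding chain_weight_def chain_def by blast
    qed (use p(1) \<open>0 < m\<close> TV False in \<open>auto simp: chain_weight_def split: if_splits\<close>)
    moreover have "bary V ?p = t"
    proof
      fix a
      show "bary V ?p a = t a"
        using \<open>card T > 0\<close> pT bary_upd[OF V TV, of p "m * card T" a]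
        by (simp add: p(2) t'_def) (simp add: T_def)
    qed
    moreover have "S \<subseteq> T" if "?p S \<noteq> 0" for S
      using psub that by (cases "S = T") auto
    ultimately show ?thesis
      unfolding T_def by blast
  qed
qed

subsection \<open>Realizations of finite complexes\<close>

lemma continuous_on_bary: "continuous_on K (\<lambda>p. bary V p a)"
proof -
  have "continuous_on K (\<lambda>p. p S)" for S :: "'a set"
    by (rule continuous_on_subset[OF continuous_on_product_coordinates subset_UNIV])
  then show ?thesis
    unfolding bary_def divide_inverse
    by (intro continuous_on_sum continuous_on_mult continuous_on_const)
qed

lemma closed_closed_face: "closed (closed_face s)"
proof -
  have c: "continuous_on UNIV (\<lambda>p::'a \<Rightarrow> real. p v)" for v
    by (rule continuous_on_product_coordinates)
  have "closed {p::'a \<Rightarrow> real. 0 \<le> p v}" "closed {p::'a \<Rightarrow> real. p v = 0}" for v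
    by (rule closed_Collect_le closed_Collect_eq; intro continuous_on_const c)+
  moreover have "closed {p::'a \<Rightarrow> real. sum p s = 1}"
    by (rule closed_Collect_eq; intro continuous_on_const continuous_on_sum c)
  moreover have "closed_face s = (\<Inter>v. {p. 0 \<le> p v}) \<inter> (\<Inter>v\<in>-s. {p. p v = 0}) \<inter> {p. sum p s = 1}"
    unfolding closed_face_def by auto
  ultimately show ?thesis
    by (metis (mono_tags, lifting) closed_INT closed_Int)
qed

text \<open>All coordinates lie in the unit interval, so the face is a closed subset of a cube that
  is compact by Tychonoff's theorem.\<close>

lemma compact_closed_face:
  assumes "finite s"
  shows "compact (closed_face s)"
proof -
  have "compact (Pi\<^sub>E UNIV (\<lambda>_::'a. {0..1::real}))"
    using compactin_PiE[of "\<lambda>_. euclidean :: real topology" "UNIV::'a set" "\<lambda>_. {0..1}"]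
    by (simp add: euclidean_product_topology)
  moreover have "p v \<le> 1" if "p \<in> closed_face s" for p v
    using that assms member_le_sum[of v s p] by (cases "v \<in> s") (auto simp: closed_face_def)
  then have "closed_face s \<subseteq> Pi\<^sub>E UNIV (\<lambda>_. {0..1})"
    by (auto simp: closed_face_def)
  ultimately show ?thesis
    using closed_closed_face by (metis compact_Int_closed inf.absorb_iff2)
qed

text \<open>The complement of a weakly open set is a finite union of closed subsets of faces, hence
  relatively closed. Cells of the homotopy colimit thereby become ordinary subspaces.\<close>

lemma geometric_realization_finite:
  assumes "finite K"
  shows "geometric_realization K = top_of_set (\<Union>s\<in>K. closed_face s)"
  unfolding topology_eq
proof (intro allI iffI)
  fix U
  let ?X = "\<Union>s\<in>K. closed_face s"
  assume "openin (geometric_realization K) U"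
  then have U: "U \<subseteq> ?X" "\<And>s. s \<in> K \<Longrightarrow> openin (top_of_set (closed_face s)) (U \<inter> closed_face s)"
    by (auto simp: openin_geometric_realization)
  have "closed (closed_face s - U)" if "s \<in> K" for s
  proof -
    have "closedin (top_of_set (closed_face s)) (closed_face s - U \<inter> closed_face s)"
      by (rule closedin_diff[OF _ U(2)[OF that]]) simp
    moreover have "closed_face s - U \<inter> closed_face s = closed_face s - U"
      by blast
    ultimately show ?thesis
      using closed_closed_face closedin_closed_trans by metis
  qed
  then have "closed (\<Union>s\<in>K. closed_face s - U)"
    using assms by blast
  moreover have "U = ?X - (\<Union>s\<in>K. closed_face s - U)"
    using U(1) by blast
  ultimately show "openin (top_of_set ?X) U"
    by (metis Diff_eq open_Compl openin_open_Int)
next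
  fix U
  let ?X = "\<Union>s\<in>K. closed_face s"
  assume "openin (top_of_set ?X) U"
  then obtain W where W: "open W" "U = ?X \<inter> W"
    by (auto simp: openin_open)
  have "U \<inter> closed_face s = closed_face s \<inter> W" if "s \<in> K" for s
    using that W by blast
  then show "openin (geometric_realization K) U"
    using W by (auto simp: openin_geometric_realization)
qed

subsection \<open>Families of affine maps\<close>

lemma affine_on_subset: "affine_on A f \<Longrightarrow> B \<subseteq> A \<Longrightarrow> affine_on B f"
  unfolding affine_on_def by blast

text \<open>The scalar \<open>s\<close> is arbitrary: two points determine the map along their whole
  line.\<close>

lemma affine_on_ray:
  assumes "affine_on B f" "x \<in> B" "x + u \<in> B"
  shows "f (x + s *\<^sub>R u) = f x + s *\<^sub>R (f (x + u) - f x)"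
proof -
  have "f ((1 - s) *\<^sub>R x + s *\<^sub>R (x + u)) = (1 - s) *\<^sub>R f x + s *\<^sub>R f (x + u)"
    using assms by (simp add: affine_on_def)
  then show ?thesis
    by (simp add: algebra_simps)
qed

text \<open>The linear part, defined on the direction space of \<open>B\<close>, extends to a linear
  map on the whole finite-dimensional space, which is continuous.\<close>

lemma continuous_on_affine_on:
  fixes f :: "'a::euclidean_space \<Rightarrow> 'b::real_normed_vector"
  assumes B: "affine B" and f: "affine_on B f"
  shows "continuous_on B f"
proof (cases "B = {}")
  case False
  then obtain x where x: "x \<in> B"
    by blast
  define S where "S = (\<lambda>y. - x + y) ` B"
  have S: "subspace S"
    unfolding S_def using affine_diffs_subspace[OF B x] .
  have S_iff: "u \<in> S \<longleftrightarrow> x + u \<in> B" for u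
    unfolding S_def by (force simp: image_iff)
  define L where "L u = f (x + u) - f x" for u
  have scale: "L (s *\<^sub>R u) = s *\<^sub>R L u" if "u \<in> S" for s u
    using affine_on_ray[OF f x, of u s] that by (simp add: L_def S_iff)
  have add: "L (u + v) = L u + L v" if "u \<in> S" "v \<in> S" for u v
  proof -
    \<comment> \<open>Additivity comes from the midpoint of \<open>x + u\<close> and
      \<open>x + v\<close>, followed by cancelling the factor 1/2.\<close>
    have "(1/2) *\<^sub>R L (u + v) = L ((1/2) *\<^sub>R (u + v))"
      using scale S that subspace_add by metis
    also have "(1/2) *\<^sub>R (x + u) + (1/2) *\<^sub>R (x + v) = x + (1/2) *\<^sub>R (u + v)"
      by (simp add: algebra_simps flip: scaleR_left_distrib)
    then have "L ((1/2) *\<^sub>R (u + v)) = (1/2) *\<^sub>R f (x + u) + (1/2) *\<^sub>R f (x + v) - f x"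
      unfolding L_def using f that by (metis S_iff affine_on_def field_sum_of_halves)
    also have "\<dots> = (1/2) *\<^sub>R (L u + L v)"
      by (simp add: L_def algebra_simps flip: scaleR_left_distrib)
    finally show ?thesis
      by simp
  qed
  obtain b where b: "b \<subseteq> S" "independent b" "S \<subseteq> span b"
    using maximal_independent_subset by blast
  obtain g where g: "linear g" "\<And>u. u \<in> b \<Longrightarrow> g u = L u"
    using linear_independent_extend[OF b(2)] by blast
  \<comment> \<open>Membership in \<open>S\<close> is carried through the induction because
    \<open>L\<close> is known to be additive and homogeneous only there.\<close>
  have "u \<in> S \<and> g u = L u" if "u \<in> span b" for u
    using that
  proof (induction rule: span_induct_alt)
    case base
    show ?case
      using S g(1) scale[of 0 0] by (simp add: subspace_0 linear_0)
  next
    case (step c u v)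
    then have "u \<in> S"
      using b by blast
    then show ?case
      using step S g by (simp add: add scale subspace_add subspace_scale linear_add linear_scale)
  qed
  then have "f y = g (y - x) + f x" if "y \<in> B" for y
  proof -
    have "y - x \<in> S"
      using that S_iff by simp
    then have "g (y - x) = L (y - x)"
      using b(3) \<open>\<And>u. u \<in> span b \<Longrightarrow> u \<in> S \<and> g u = L u\<close> by blast
    then show ?thesis
      by (simp add: L_def)
  qed
  moreover have "continuous_on B (\<lambda>y. g (y - x) + f x)"
  proof -
    have "bounded_linear g"
      using g(1) by (simp add: linear_conv_bounded_linear)
    from linear_continuous_on[OF this, of UNIV] have "continuous_on B (\<lambda>y. g (y - x))"
      by (rule continuous_on_compose2) (intro continuous_on_diff continuous_on_id continuous_on_const subset_UNIV)+
    then show ?thesis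
      by (rule continuous_on_add) (rule continuous_on_const)
  qed
  ultimately show ?thesis
    by (metis (no_types, lifting) continuous_on_eq)
qed auto

text \<open>The reparametrisations \<open>a\<close> and \<open>b\<close> cover both joint continuity
  and the case where the point of \<open>B\<close> is frozen.\<close>

lemma continuous_on_affine_family:
  fixes f :: "'i \<Rightarrow> 'a::euclidean_space \<Rightarrow> 'b::real_normed_vector"
    and t :: "'i \<Rightarrow> 'k::topological_space \<Rightarrow> real"
  assumes t: "\<And>i. i \<in> I \<Longrightarrow> continuous_on K (t i)"
    and B: "affine B" and f: "\<And>i. i \<in> I \<Longrightarrow> affine_on B (f i)"
    and a: "continuous_on S a" and b: "continuous_on S b" and "a ` S \<subseteq> K" "b ` S \<subseteq> B"
  shows "continuous_on S (\<lambda>z. \<Sum>i\<in>I. t i (a z) *\<^sub>R f i (b z))"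
proof -
  have "continuous_on S (\<lambda>z. t i (a z))" if "i \<in> I" for i
    by (rule continuous_on_compose2[OF t[OF that] a \<open>a ` S \<subseteq> K\<close>])
  moreover have "continuous_on S (\<lambda>z. f i (b z))" if "i \<in> I" for i
    by (rule continuous_on_compose2[OF continuous_on_affine_on[OF B f[OF that]] b \<open>b ` S \<subseteq> B\<close>])
  ultimately show ?thesis
    by (intro continuous_on_sum continuous_on_scaleR)
qed

text \<open>Injectivity makes the linear part of each member of the family injective, so by compactness of \<open>K\<close>
  the family expands distances from a base point by a uniform factor; hence it is proper.\<close>

lemma closed_affine_family_image:
  fixes f :: "'i \<Rightarrow> 'a::euclidean_space \<Rightarrow> 'b::real_normed_vector"
    and t :: "'i \<Rightarrow> 'k::topological_space \<Rightarrow> real"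
  assumes K: "compact K" and t: "\<And>i. i \<in> I \<Longrightarrow> continuous_on K (t i)"
    and B: "affine B" and f: "\<And>i. i \<in> I \<Longrightarrow> affine_on B (f i)"
    and inj: "\<And>p. p \<in> K \<Longrightarrow> inj_on (\<lambda>x. \<Sum>i\<in>I. t i p *\<^sub>R f i x) B"
    and C: "closedin (top_of_set (K \<times> B)) C"
  shows "closed ((\<lambda>(p, x). \<Sum>i\<in>I. t i p *\<^sub>R f i x) ` C)"
proof (cases "C = {}")
  case False
  define g where "g p x = (\<Sum>i\<in>I. t i p *\<^sub>R f i x)" for p x
  have contI: "continuous_on S (\<lambda>z. g (a z) (b z))"
    if "continuous_on S a" "continuous_on S b" "a ` S \<subseteq> K" "b ` S \<subseteq> B"
    for a b and S :: "('k \<times> 'a) set"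
    unfolding g_def using continuous_on_affine_family[OF t B f that] .
  have "C \<subseteq> K \<times> B"
    using C closedin_imp_subset by blast
  then obtain x0 where x0: "x0 \<in> B" and "K \<noteq> {}"
    using False by auto
  have "\<exists>c>0. \<forall>p\<in>K. \<forall>x\<in>B. c * norm (x - x0) \<le> norm (g p x - g p x0)"
  proof (cases "B = {x0}")
    \<comment> \<open>The unit sphere in \<open>B\<close> is empty here, so no minimum can be taken;
      both sides of the estimate vanish.\<close>
    case True
    then show ?thesis
      by (auto intro: exI[of _ 1])
  next
    case False
    define U where "U = {y \<in> B. dist x0 y = 1}"
    have "compact U"
    proof -
      have "U = B \<inter> sphere x0 1"
        by (auto simp: U_def)
      then show ?thesis
        using affine_closed[OF B] by (simp add: closed_Int_compact)
    qed
    obtain x1 where x1: "x1 \<in> B" "x1 \<noteq> x0"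
      using False x0 by blast
    have unit: "x0 + (1 / norm (x - x0)) *\<^sub>R (x - x0) \<in> U" if "x \<in> B" "x \<noteq> x0" for x
    proof -
      have "(1 - 1 / norm (x - x0)) *\<^sub>R x0 + (1 / norm (x - x0)) *\<^sub>R x \<in> B"
        using B x0 that unfolding affine_def by (metis diff_add_cancel)
      moreover have "(1 - 1 / norm (x - x0)) *\<^sub>R x0 + (1 / norm (x - x0)) *\<^sub>R x
        = x0 + (1 / norm (x - x0)) *\<^sub>R (x - x0)"
        by (simp add: algebra_simps)
      ultimately show ?thesis
        using that by (simp add: U_def dist_norm)
    qed
    \<comment> \<open>The expansion factor is the least displacement over \<open>K\<close> and the
      unit sphere \<open>U\<close>; it is attained by compactness and positive by
      injectivity.\<close>
    have "compact (K \<times> U)" "K \<times> U \<noteq> {}"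
      using K \<open>compact U\<close> unit[OF x1] \<open>K \<noteq> {}\<close> by (auto intro: compact_Times)
    moreover have "continuous_on (K \<times> U) (\<lambda>z. norm (g (fst z) (snd z) - g (fst z) x0))"
      using x0 by (intro continuous_on_norm continuous_on_diff contI continuous_on_fst continuous_on_snd
          continuous_on_id continuous_on_const) (auto simp: U_def)
    ultimately obtain z where z: "z \<in> K \<times> U"
      "\<And>w. w \<in> K \<times> U \<Longrightarrow> norm (g (fst z) (snd z) - g (fst z) x0) \<le> norm (g (fst w) (snd w) - g (fst w) x0)"
      using continuous_attains_inf[of "K \<times> U"] by blast
    define c where "c = norm (g (fst z) (snd z) - g (fst z) x0)"
    have "snd z \<in> B" "snd z \<noteq> x0" "fst z \<in> K"
      using z(1) by (auto simp: U_def)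
    then have "c > 0"
      using inj[of "fst z"] x0 unfolding c_def g_def inj_on_def by auto
    moreover have "c * norm (x - x0) \<le> norm (g p x - g p x0)" if "p \<in> K" "x \<in> B" for p x
    proof (cases "x = x0")
      case False
      let ?s = "norm (x - x0)" and ?u = "(1 / norm (x - x0)) *\<^sub>R (x - x0)"
      have uB: "x0 + ?u \<in> B"
        using unit[OF that(2) False] by (simp add: U_def)
      \<comment> \<open>Along the ray from \<open>x0\<close> through \<open>x\<close> displacements
        scale with the distance, which reduces the estimate to the unit sphere.\<close>
      have "f i x = f i x0 + ?s *\<^sub>R (f i (x0 + ?u) - f i x0)" if "i \<in> I" for i
        using affine_on_ray[OF f[OF that] x0 uB, of ?s] False by simp
      then have "g p x - g p x0 = (\<Sum>i\<in>I. t i p *\<^sub>R (?s *\<^sub>R (f i (x0 + ?u) - f i x0)))"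
        unfolding g_def by (simp flip: sum_subtractf scaleR_diff_right)
      also have "\<dots> = ?s *\<^sub>R (g p (x0 + ?u) - g p x0)"
        unfolding g_def
        by (simp add: scaleR_sum_right mult.commute flip: sum_subtractf scaleR_diff_right)
      finally have "norm (g p x - g p x0) = ?s * norm (g p (x0 + ?u) - g p x0)"
        by simp
      moreover have "c \<le> norm (g p (x0 + ?u) - g p x0)"
        using z(2)[of "(p, x0 + ?u)"] that(1) unit[OF that(2) False] by (simp add: c_def)
      ultimately show ?thesis
        by (metis mult.commute mult_right_mono norm_ge_zero)
    qed simp
    ultimately show ?thesis
      by blast
  qed
  then obtain c where c: "c > 0"
    "\<And>p x. p \<in> K \<Longrightarrow> x \<in> B \<Longrightarrow> c * norm (x - x0) \<le> norm (g p x - g p x0)"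
    by blast
  have "compact ((\<lambda>p. g p x0) ` K)"
  proof (rule compact_continuous_image[OF _ K])
    show "continuous_on K (\<lambda>p. g p x0)"
      unfolding g_def
      by (rule continuous_on_affine_family[OF t B f continuous_on_id continuous_on_const]) (use x0 in auto)
  qed
  from compact_imp_bounded[OF this] obtain d where d: "\<And>p. p \<in> K \<Longrightarrow> norm (g p x0) \<le> d"
    unfolding bounded_iff by auto
  let ?G = "\<lambda>(p, x). g p x"
  \<comment> \<open>A bounded part of \<open>C\<close> is compact, so its image is closed. It
    remains to see that near any given point the image comes from such a part.\<close>
  have loc: "closed (?G ` (C \<inter> (K \<times> cball x0 r)))" for r
  proof -
    have "compact (C \<inter> (K \<times> cball x0 r))"
    proof -
      obtain D where D: "closed D" "C = (K \<times> B) \<inter> D"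
        using C by (auto simp: closedin_closed)
      then have "C \<inter> (K \<times> cball x0 r) = D \<inter> (K \<times> (B \<inter> cball x0 r))"
        by auto
      moreover have "compact (K \<times> (B \<inter> cball x0 r))"
        using K affine_closed[OF B] by (intro compact_Times) (auto intro: closed_Int_compact)
      ultimately show ?thesis
        using D by (metis closed_Int_compact)
    qed
    moreover have "continuous_on (C \<inter> (K \<times> cball x0 r)) ?G"
      unfolding case_prod_beta using \<open>C \<subseteq> K \<times> B\<close>
      by (intro contI[OF continuous_on_fst[OF continuous_on_id] continuous_on_snd[OF continuous_on_id]]) auto
    ultimately show ?thesis
      using compact_continuous_image compact_imp_closed by blast
  qed
  have "y \<in> ?G ` C" if y: "y \<in> closure (?G ` C)" for y
  proof -
    \<comment> \<open>If \<open>g p x\<close> lies within 1 of \<open>y\<close>, then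
      \<open>c * norm (x - x0)\<close> is at most \<open>norm (g p x) + norm (g p x0)\<close>, hence
      at most \<open>norm y + 1 + d\<close>.\<close>
    define r where "r = (norm y + 1 + d) / c"
    have "y \<in> closure (?G ` C \<inter> ball y 1)"
      using y by (metis Int_commute IntI closure_open_Int_superset centre_in_ball open_ball
        open_Int_closure_subset subsetD zero_less_one)
    moreover have "?G ` C \<inter> ball y 1 \<subseteq> ?G ` (C \<inter> (K \<times> cball x0 r))"
    proof
      fix w assume w: "w \<in> ?G ` C \<inter> ball y 1"
      then obtain p x where px: "(p, x) \<in> C" "w = g p x"
        by auto
      then have "p \<in> K" "x \<in> B"
        using \<open>C \<subseteq> K \<times> B\<close> by auto
      have "norm (g p x) \<le> norm y + 1"
        using w norm_triangle_sub[of w y] by (auto simp: dist_norm norm_minus_commute simp flip: px(2))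
      then have "c * norm (x - x0) \<le> norm y + 1 + d"
        using c(2)[OF \<open>p \<in> K\<close> \<open>x \<in> B\<close>] d[OF \<open>p \<in> K\<close>] norm_triangle_ineq4[of "g p x" "g p x0"]
        by linarith
      then have "norm (x - x0) \<le> r"
        using c(1) by (simp add: r_def field_simps)
      then have "(p, x) \<in> C \<inter> (K \<times> cball x0 r)"
        using px \<open>p \<in> K\<close> by (simp add: dist_norm norm_minus_commute)
      then show "w \<in> ?G ` (C \<inter> (K \<times> cball x0 r))"
        using px(2) by force
    qed
    ultimately show ?thesis
      using closure_minimal[OF _ loc] by blast
  qed
  then have "closed (?G ` C)"
    by (meson closure_subset_eq subsetI)
  then show ?thesis
    by (simp add: g_def)
qed simp

subsection \<open>Topological preliminaries\<close>

text \<open>Open neighbourhoods of \<open>None\<close> are complements of closed compact sets. The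
  preimage of such a set under \<open>f\<close> is its image under the continuous inverse
  \<open>g\<close>, hence again compact.\<close>

lemma continuous_map_Alexandroff_compactification:
  assumes "homeomorphic_maps X Y f g"
  shows "continuous_map (Alexandroff_compactification X) (Alexandroff_compactification Y) (map_option f)"
  unfolding continuous_map_def
proof (intro conjI allI impI)
  have f: "continuous_map X Y f" and g: "continuous_map Y X g"
    and gf: "\<And>x. x \<in> topspace X \<Longrightarrow> g (f x) = x" and fg: "\<And>y. y \<in> topspace Y \<Longrightarrow> f (g y) = y"
    using assms by (auto simp: homeomorphic_maps_def)
  have fX: "f x \<in> topspace Y" if "x \<in> topspace X" for x
    using continuous_map_image_subset_topspace[OF f] that by blast
  have gY: "g y \<in> topspace X" if "y \<in> topspace Y" for y
    using continuous_map_image_subset_topspace[OF g] that by blast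
  show "map_option f \<in> topspace (Alexandroff_compactification X) \<rightarrow> topspace (Alexandroff_compactification Y)"
    using fX by auto
  fix W assume W: "openin (Alexandroff_compactification Y) W"
  let ?P = "{z \<in> topspace (Alexandroff_compactification X). map_option f z \<in> W}"
  from W consider U where "openin Y U" "W = Some ` U"
    | C where "compactin Y C" "closedin Y C" "W = insert None (Some ` (topspace Y - C))"
    unfolding openin_Alexandroff_compactification by blast
  then show "openin (Alexandroff_compactification X) ?P"
  proof cases
    case 1
    then have "?P = Some ` {x \<in> topspace X. f x \<in> U}"
      by auto
    then show ?thesis
      using openin_continuous_map_preimage[OF f 1(1)] by simp
  next
    case 2
    have CY: "C \<subseteq> topspace Y"
      using 2(2) closedin_subset by blast
    have img: "g ` C = {x \<in> topspace X. f x \<in> C}"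
      using CY gf fg gY by force
    have "?P = insert None (Some ` (topspace X - g ` C))"
      unfolding img using 2(3) fX by auto
    moreover have "compactin X (g ` C)"
      using image_compactin[OF 2(1) g] .
    moreover have "closedin X (g ` C)"
      unfolding img using closedin_continuous_map_preimage[OF f 2(2)] .
    ultimately show ?thesis
      unfolding openin_Alexandroff_compactification by blast
  qed
qed

lemma homeomorphic_space_Alexandroff_compactification:
  assumes "X homeomorphic_space Y"
  shows "Alexandroff_compactification X homeomorphic_space Alexandroff_compactification Y"
proof -
  obtain f g where fg: "homeomorphic_maps X Y f g"
    using assms unfolding homeomorphic_space_def by blast
  then have gf: "homeomorphic_maps Y X g f"
    using homeomorphic_maps_sym by blast
  have "map_option g (map_option f x) = x" if "x \<in> topspace (Alexandroff_compactification X)" for x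
    using that fg by (auto simp: homeomorphic_maps_def)
  moreover have "map_option f (map_option g y) = y" if "y \<in> topspace (Alexandroff_compactification Y)" for y
    using that fg by (auto simp: homeomorphic_maps_def)
  ultimately have "homeomorphic_maps (Alexandroff_compactification X) (Alexandroff_compactification Y)
      (map_option f) (map_option g)"
    unfolding homeomorphic_maps_def
    using continuous_map_Alexandroff_compactification[OF fg]
      continuous_map_Alexandroff_compactification[OF gf] by blast
  then show ?thesis
    unfolding homeomorphic_space_def by blast
qed

section \<open>Quotient maps and topological sums\<close>

text \<open>Each quotient map factors through the other, and surjectivity makes the two factors
  mutually inverse.\<close>

lemma quotient_maps_same_fibres_imp_homeomorphic_space:
  assumes f: "quotient_map X Y f" and g: "quotient_map X Z g"
    and fib: "\<And>x y. x \<in> topspace X \<Longrightarrow> y \<in> topspace X \<Longrightarrow> f x = f y \<longleftrightarrow> g x = g y"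
  shows "Y homeomorphic_space Z"
proof -
  obtain h where h: "continuous_map Y Z h" "\<And>x. x \<in> topspace X \<Longrightarrow> h (f x) = g x"
    using quotient_map_lift_exists[OF f quotient_imp_continuous_map[OF g]] fib by metis
  obtain k where k: "continuous_map Z Y k" "\<And>x. x \<in> topspace X \<Longrightarrow> k (g x) = f x"
    using quotient_map_lift_exists[OF g quotient_imp_continuous_map[OF f]] fib by metis
  have "k (h y) = y" if "y \<in> topspace Y" for y
  proof -
    have "y \<in> f ` topspace X"
      using that by (simp only: quotient_imp_surjective_map[OF f])
    then show ?thesis
      using h(2) k(2) by (auto simp only:)
  qed
  moreover have "h (k z) = z" if "z \<in> topspace Z" for z
  proof -
    have "z \<in> g ` topspace X"
      using that by (simp only: quotient_imp_surjective_map[OF g])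
    then show ?thesis
      using h(2) k(2) by (auto simp only:)
  qed
  ultimately show ?thesis
    using h k unfolding homeomorphic_space_def homeomorphic_maps_def by blast
qed

lemma continuous_map_from_sum_topology:
  assumes "\<And>i. i \<in> I \<Longrightarrow> continuous_map (X i) Y (\<lambda>x. f (i, x))"
  shows "continuous_map (sum_topology X I) Y f"
  unfolding continuous_map_def
proof (intro conjI allI impI)
  show "f \<in> topspace (sum_topology X I) \<rightarrow> topspace Y"
    using assms by (fastforce simp: continuous_map_def)
  fix U assume U: "openin Y U"
  have "openin (X i) {x. (i, x) \<in> {z \<in> topspace (sum_topology X I). f z \<in> U}}" if "i \<in> I" for i
  proof -
    have "{x. (i, x) \<in> {z \<in> topspace (sum_topology X I). f z \<in> U}} = {x \<in> topspace (X i). f (i, x) \<in> U}"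
      using that by auto
    then show ?thesis
      using openin_continuous_map_preimage[OF assms[OF that] U] by simp
  qed
  then show "openin (sum_topology X I) {z \<in> topspace (sum_topology X I). f z \<in> U}"
    unfolding openin_sum_topology by auto
qed

text \<open>The image is a union of one closed set per summand, which is closed because
  \<open>I\<close> is finite.\<close>

lemma closed_map_from_sum_topology:
  assumes "finite I" "\<And>i. i \<in> I \<Longrightarrow> closed_map (X i) Y (\<lambda>x. f (i, x))"
  shows "closed_map (sum_topology X I) Y f"
  unfolding closed_map_def
proof (intro allI impI)
  fix C assume "closedin (sum_topology X I) C"
  then have C: "C \<subseteq> Sigma I (topspace \<circ> X)" "\<And>i. i \<in> I \<Longrightarrow> closedin (X i) {x. (i, x) \<in> C}"
    by (auto simp: closedin_sum_topology)
  have "f ` C = (\<Union>i\<in>I. (\<lambda>x. f (i, x)) ` {x. (i, x) \<in> C})"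
    using C(1) by force
  moreover have "closedin Y ((\<lambda>x. f (i, x)) ` {x. (i, x) \<in> C})" if "i \<in> I" for i
    using assms(2)[OF that] C(2)[OF that] unfolding closed_map_def by blast
  ultimately show "closedin Y (f ` C)"
    using assms(1) by (auto intro: closedin_Union)
qed

section \<open>Finite chains and order complexes\<close>

text \<open>In a partial order \<open>LEAST\<close> is meaningful only once a least element is known
  to exist; in a chain a minimal element is one.\<close>

lemma finite_chain_Least:
  fixes c :: "'a::order set"
  assumes "finite c" "c \<noteq> {}" "Complete_Partial_Order.chain (\<le>) c"
  shows "(LEAST x. x \<in> c) \<in> c" and "\<And>y. y \<in> c \<Longrightarrow> (LEAST x. x \<in> c) \<le> y"
proof -
  obtain m where m: "m \<in> c" "\<forall>b\<in>c. b \<le> m \<longrightarrow> m = b"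
    using finite_has_minimal assms(1,2) by metis
  have "m \<le> y" if "y \<in> c" for y
    using assms(3) m that unfolding chain_def by (metis order_refl)
  moreover from this have "(LEAST x. x \<in> c) = m"
    using m(1) by (intro Least_equality)
  ultimately show "(LEAST x. x \<in> c) \<in> c" "\<And>y. y \<in> c \<Longrightarrow> (LEAST x. x \<in> c) \<le> y"
    using m(1) by simp_all
qed

lemma finite_chain_Greatest:
  fixes c :: "'a::order set"
  assumes "finite c" "c \<noteq> {}" "Complete_Partial_Order.chain (\<le>) c"
  shows "(GREATEST x. x \<in> c) \<in> c" and "\<And>y. y \<in> c \<Longrightarrow> y \<le> (GREATEST x. x \<in> c)"
proof -
  obtain m where m: "m \<in> c" "\<forall>b\<in>c. m \<le> b \<longrightarrow> m = b"
    using finite_has_maximal assms(1,2) by metis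
  have "y \<le> m" if "y \<in> c" for y
    using assms(3) m that unfolding chain_def by (metis order_refl)
  moreover from this have "(GREATEST x. x \<in> c) = m"
    using m(1) by (intro Greatest_equality)
  ultimately show "(GREATEST x. x \<in> c) \<in> c" "\<And>y. y \<in> c \<Longrightarrow> y \<le> (GREATEST x. x \<in> c)"
    using m(1) by simp_all
qed

lemma finite_order_complex: "finite P \<Longrightarrow> finite (order_complex P)"
  by (rule finite_subset[of _ "Pow P"]) (auto simp: order_complex_def)

text \<open>Nonempty subsets of chains are chains, so the support of \<open>p\<close> is itself a
  simplex, the smallest one containing \<open>p\<close>.\<close>

lemma order_complex_faces_iff:
  "p \<in> (\<Union>s\<in>order_complex P. closed_face s) \<longleftrightarrow>
     (\<forall>v. 0 \<le> p v) \<and> {v. p v \<noteq> 0} \<in> order_complex P \<and> sum p {v. p v \<noteq> 0} = 1"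
proof
  assume "p \<in> (\<Union>s\<in>order_complex P. closed_face s)"
  then obtain s where s: "s \<in> order_complex P" "p \<in> closed_face s"
    by blast
  have sub: "{v. p v \<noteq> 0} \<subseteq> s" and "finite s"
    using s by (auto simp: closed_face_def order_complex_def)
  then have "sum p {v. p v \<noteq> 0} = sum p s"
    by (intro sum.mono_neutral_left) auto
  also have "\<dots> = 1"
    using s(2) by (simp add: closed_face_def)
  finally have 1: "sum p {v. p v \<noteq> 0} = 1" .
  then have "{v. p v \<noteq> 0} \<noteq> {}"
    by (metis sum.empty zero_neq_one)
  then have "{v. p v \<noteq> 0} \<in> order_complex P"
    using s(1) sub unfolding order_complex_def
    by (auto intro: finite_subset[OF sub] chain_subset[OF _ sub])
  then show "(\<forall>v. 0 \<le> p v) \<and> {v. p v \<noteq> 0} \<in> order_complex P \<and> sum p {v. p v \<noteq> 0} = 1"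
    using 1 s(2) by (simp add: closed_face_def)
next
  assume "(\<forall>v. 0 \<le> p v) \<and> {v. p v \<noteq> 0} \<in> order_complex P \<and> sum p {v. p v \<noteq> 0} = 1"
  then have "p \<in> closed_face {v. p v \<noteq> 0}" "{v. p v \<noteq> 0} \<in> order_complex P"
    by (auto simp: closed_face_def)
  then show "p \<in> (\<Union>s\<in>order_complex P. closed_face s)"
    by blast
qed

text \<open>When all maps act as the identity, gluing changes only the index of the object.\<close>

lemma equivclp_glue_snd:
  assumes "equivclp (glue D) a b" and "\<And>x y v. mor D x y v = v"
  shows "snd a = snd b"
  using assms(1)
proof (induction rule: equivclp_induct)
  case (step y z)
  then show ?case
    using assms(2) by (auto elim!: glue.cases)
qed simp

subsection \<open>The homotopy colimit of the Vassiliev diagram\<close>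

locale resolved_arrangement =
  fixes \<A> :: "(real^'n) set set" and \<phi> :: "(real^'n) set \<Rightarrow> real^'n \<Rightarrow> real^'m"
  assumes arrangement: "affine_arrangement \<A>" and embeddings: "resolution_embeddings \<A> \<phi>"
begin

lemma finite_arrangement: "finite \<A>"
  using arrangement by (simp add: affine_arrangement_def)

text \<open>A join is a nonempty set inside the intersection; conversely a nonempty intersection is
  itself the join.\<close>

lemma nerve_complex_iff: "S \<in> nerve_complex \<A> \<longleftrightarrow> S \<subseteq> \<A> \<and> S \<noteq> {} \<and> \<Inter>S \<noteq> {}"
proof
  assume "S \<in> nerve_complex \<A>"
  then obtain J where S: "S \<subseteq> \<A>" "S \<noteq> {}"
    and J: "J \<in> intersection_semilattice \<A>" "\<forall>A\<in>S. J \<subseteq> A"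
    unfolding nerve_complex_def has_join_def by auto
  have "J \<noteq> {}"
    using J(1) unfolding intersection_semilattice_def by fastforce
  moreover have "J \<subseteq> \<Inter>S"
    using J(2) by (simp add: le_Inf_iff)
  ultimately show "S \<subseteq> \<A> \<and> S \<noteq> {} \<and> \<Inter>S \<noteq> {}"
    using S by auto
next
  assume S: "S \<subseteq> \<A> \<and> S \<noteq> {} \<and> \<Inter>S \<noteq> {}"
  then have "\<Inter>S \<in> intersection_semilattice \<A>"
    unfolding intersection_semilattice_def by blast
  then have "has_join (intersection_semilattice \<A>) S"
    unfolding has_join_def by (meson Inter_lower Inter_greatest)
  then show "S \<in> nerve_complex \<A>"
    using S by (simp add: nerve_complex_def)
qed

lemma finite_nerve_complex: "finite (nerve_complex \<A>)"
  by (rule finite_subset[of _ "Pow \<A>"]) (auto simp: nerve_complex_def finite_arrangement)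

section \<open>Points of the homotopy colimit and their images in the resolution\<close>

text \<open>A point of the homotopy colimit with the index of its cell forgotten, as gluing
  identifies points that differ only in that index.\<close>

definition resolution_pair :: "((real^'n) set set \<Rightarrow> real) \<Rightarrow> real^'n \<Rightarrow> bool" where
  "resolution_pair p x \<longleftrightarrow> chain_weight \<A> p \<and> sum p (Pow \<A>) = 1 \<and> (\<forall>S. p S \<noteq> 0 \<longrightarrow> x \<in> \<Inter>S)"

definition resolution_point :: "((real^'n) set set \<Rightarrow> real) \<Rightarrow> real^'n \<Rightarrow> real^'m" where
  "resolution_point p x = (\<Sum>A\<in>\<A>. bary \<A> p A *\<^sub>R \<phi> A x)"

definition through :: "real^'n \<Rightarrow> (real^'n) set set" where
  "through x = {A \<in> \<A>. x \<in> A}"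

lemma finite_through: "finite (through x)"
  by (simp add: through_def finite_arrangement)

lemma resolution_fibre_eq: "resolution_fibre \<A> \<phi> x = convex hull ((\<lambda>A. \<phi> A x) ` through x)"
  unfolding resolution_fibre_def through_def by (rule arg_cong[of _ _ "\<lambda>S. convex hull S"]) auto

text \<open>Such an \<open>A\<close> belongs to a chain member whose intersection contains
  \<open>x\<close>. Hence the coordinates of \<open>p\<close> are weights on the vertices of the
  fibre over \<open>x\<close>.\<close>

lemma bary_through:
  assumes "resolution_pair p x" "bary \<A> p A \<noteq> 0"
  shows "A \<in> through x"
proof -
  have p: "chain_weight \<A> p" and x: "\<And>S. p S \<noteq> 0 \<Longrightarrow> x \<in> \<Inter>S"
    using assms(1) by (auto simp: resolution_pair_def)
  obtain S where "p S \<noteq> 0" "A \<in> S"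
    using assms(2) bary_pos_iff[OF finite_arrangement p] by blast
  then show ?thesis
    using x chain_weight_subset[OF p] unfolding through_def by blast
qed

lemma sum_bary_through:
  assumes "resolution_pair p x"
  shows "(\<Sum>A\<in>through x. bary \<A> p A) = 1"
proof -
  have p: "chain_weight \<A> p" and 1: "sum p (Pow \<A>) = 1"
    using assms by (auto simp: resolution_pair_def)
  have "p {} = 0"
    using chain_weight_nonempty[OF p] by blast
  then have "(\<Sum>A\<in>\<A>. bary \<A> p A) = 1"
    using sum_bary[OF finite_arrangement] 1 by metis
  moreover have "(\<Sum>A\<in>through x. bary \<A> p A) = (\<Sum>A\<in>\<A>. bary \<A> p A)"
    using bary_through[OF assms] finite_arrangement
    by (intro sum.mono_neutral_left) (auto simp: through_def)
  ultimately show ?thesis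
    by simp
qed

lemma resolution_point_through:
  assumes "resolution_pair p x"
  shows "resolution_point p x = (\<Sum>A\<in>through x. bary \<A> p A *\<^sub>R \<phi> A x)"
  unfolding resolution_point_def using bary_through[OF assms] finite_arrangement
  by (intro sum.mono_neutral_right) (auto simp: through_def)

lemma resolution_point_in_fibre:
  assumes "resolution_pair p x"
  shows "resolution_point p x \<in> resolution_fibre \<A> \<phi> x"
  unfolding resolution_point_through[OF assms] resolution_fibre_eq
proof (rule convex_sum[OF finite_through convex_convex_hull sum_bary_through[OF assms]])
  show "0 \<le> bary \<A> p A" for A
    using assms by (auto simp: resolution_pair_def bary_nonneg)
qed (auto intro: hull_inc)

lemma resolution_pair_in_arrangement:
  assumes "resolution_pair p x"
  shows "x \<in> \<Union>\<A>"
proof -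
  have "through x \<noteq> {}"
    using sum_bary_through[OF assms] by force
  then show ?thesis
    by (auto simp: through_def)
qed

lemma inj_on_through: "x \<in> \<Union>\<A> \<Longrightarrow> inj_on (\<lambda>A. \<phi> A x) (through x)"
  using embeddings unfolding resolution_embeddings_def through_def by blast

lemma affine_independent_through:
  assumes "x \<in> \<Union>\<A>"
  shows "\<not> affine_dependent ((\<lambda>A. \<phi> A x) ` through x)"
proof -
  have "(\<lambda>A. \<phi> A x) ` through x = {\<phi> A x | A. A \<in> \<A> \<and> x \<in> A}"
    by (auto simp: through_def)
  moreover have "\<not> affine_dependent {\<phi> A x | A. A \<in> \<A> \<and> x \<in> A}"
    using embeddings assms unfolding resolution_embeddings_def by blast
  ultimately show ?thesis
    by metis
qed

text \<open>Disjointness of the fibres gives \<open>x = y\<close>, affine independence of the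
  vertices gives equal coordinates, and \<open>bary_inj\<close> gives \<open>p = q\<close>.\<close>

lemma resolution_point_inj:
  assumes p: "resolution_pair p x" and q: "resolution_pair q y" and eq: "resolution_point p x = resolution_point q y"
  shows "p = q" "x = y"
proof -
  show xy: "x = y"
    using resolution_point_in_fibre[OF p] resolution_point_in_fibre[OF q] eq embeddings
      resolution_pair_in_arrangement[OF p] resolution_pair_in_arrangement[OF q]
    unfolding resolution_embeddings_def by (metis IntI empty_iff)
  have x: "x \<in> \<Union>\<A>"
    by (rule resolution_pair_in_arrangement[OF p])
  let ?f = "\<lambda>A. \<phi> A x" and ?d = "\<lambda>A. bary \<A> p A - bary \<A> q A"
  \<comment> \<open>Affine dependence is stated for a set of points, so the coefficients are carried
    from the subspaces to the vertices by inverting the vertex map.\<close>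
  let ?u = "\<lambda>v. ?d (the_inv_into (through x) ?f v)"
  note inj = inj_on_through[OF x]
  have u: "?u (?f A) = ?d A" if "A \<in> through x" for A
    using the_inv_into_f_f[OF inj that] by simp
  have "sum ?u (?f ` through x) = (\<Sum>A\<in>through x. ?d A)"
    by (simp add: sum.reindex[OF inj] u)
  also have "\<dots> = 0"
    using sum_bary_through[OF p] sum_bary_through[OF q] xy by (simp add: sum_subtractf)
  finally have s0: "sum ?u (?f ` through x) = 0" .
  have "(\<Sum>v\<in>?f ` through x. ?u v *\<^sub>R v) = (\<Sum>A\<in>through x. ?d A *\<^sub>R \<phi> A x)"
    by (simp add: sum.reindex[OF inj] u)
  also have "\<dots> = 0"
    using resolution_point_through[OF p] resolution_point_through[OF q] eq xy by (simp add: scaleR_left_diff_distrib sum_subtractf)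
  finally have v0: "(\<Sum>v\<in>?f ` through x. ?u v *\<^sub>R v) = 0" .
  have zero: "?d A = 0" if "A \<in> through x" for A
  proof (rule ccontr)
    assume "?d A \<noteq> 0"
    then have "\<exists>v\<in>?f ` through x. ?u v \<noteq> 0"
      by (intro bexI[OF _ imageI[OF that]]) (simp only: u[OF that] not_False_eq_True)
    then show False
      using affine_independent_through[OF x] s0 v0
      unfolding affine_dependent_explicit_finite[OF finite_imageI[OF finite_through]] by blast
  qed
  have "bary \<A> p A = bary \<A> q A" for A
  proof (cases "A \<in> through x")
    case False
    then show ?thesis
      using bary_through[OF p, of A] bary_through[OF q, of A] xy by metis
  qed (use zero in auto)
  then show "p = q"
    using bary_inj[OF finite_arrangement] p q unfolding resolution_pair_def by blast
qed

text \<open>Convex coordinates in the fibre over \<open>x\<close> are turned into a weighted chain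
  by \<open>bary_surj\<close>. Its support clause puts \<open>x\<close> into every subspace of every
  chain member.\<close>

lemma resolution_point_surj:
  assumes "y \<in> geometric_resolution \<A> \<phi>"
  obtains p x where "resolution_pair p x" "resolution_point p x = y"
proof -
  obtain x where x: "x \<in> \<Union>\<A>" "y \<in> resolution_fibre \<A> \<phi> x"
    using assms unfolding geometric_resolution_def by blast
  let ?f = "\<lambda>A. \<phi> A x"
  note inj = inj_on_through[OF x(1)]
  obtain u where u: "\<forall>v\<in>?f ` through x. 0 \<le> u v" "sum u (?f ` through x) = 1"
    "(\<Sum>v\<in>?f ` through x. u v *\<^sub>R v) = y"
    using x(2) unfolding resolution_fibre_eq convex_hull_finite[OF finite_imageI[OF finite_through]]
    by blast
  define t where "t A = (if A \<in> through x then u (\<phi> A x) else 0)" for A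
  have "0 \<le> t A" for A
    using u(1) by (simp add: t_def)
  moreover have supp: "{A. t A \<noteq> 0} \<subseteq> through x"
    by (auto simp: t_def)
  moreover have "through x \<subseteq> \<A>"
    by (auto simp: through_def)
  ultimately obtain p where p: "chain_weight \<A> p" "bary \<A> p = t"
    "\<And>S. p S \<noteq> 0 \<Longrightarrow> S \<subseteq> {A. t A \<noteq> 0}"
    using bary_surj[OF finite_arrangement, of t] by blast
  have "sum p (Pow \<A>) = (\<Sum>A\<in>\<A>. t A)"
    using sum_bary[OF finite_arrangement, of p] chain_weight_nonempty[OF p(1)] p(2) by fastforce
  also have "\<dots> = (\<Sum>A\<in>through x. t A)"
    using finite_arrangement by (intro sum.mono_neutral_right) (auto simp: t_def through_def)
  also have "\<dots> = 1"
    using u(2) by (simp add: sum.reindex[OF inj] t_def)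
  finally have "sum p (Pow \<A>) = 1" .
  moreover have "x \<in> \<Inter>S" if "p S \<noteq> 0" for S
    using p(3)[OF that] supp by (auto simp: through_def)
  ultimately have v: "resolution_pair p x"
    using p(1) by (simp add: resolution_pair_def)
  have "resolution_point p x = (\<Sum>A\<in>through x. t A *\<^sub>R \<phi> A x)"
    using resolution_point_through[OF v] p(2) by simp
  also have "\<dots> = y"
    using u(3) by (simp add: sum.reindex[OF inj] t_def)
  finally show thesis
    using that v by blast
qed

lemma resolution_pair_top:
  assumes "resolution_pair p x"
  obtains T where "p T \<noteq> 0" "\<And>S. p S \<noteq> 0 \<Longrightarrow> S \<subseteq> T"
proof -
  have p: "chain_weight \<A> p" and "sum p (Pow \<A>) = 1"
    using assms by (auto simp: resolution_pair_def)
  then obtain S where "p S \<noteq> 0"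
    by (metis sum.neutral zero_neq_one)
  then show thesis
    using chain_weight_top[OF finite_arrangement p] that by blast
qed

section \<open>Cells of the homotopy colimit\<close>

abbreviation "faces \<equiv> nerve_complex \<A>"
abbreviation "cells \<equiv> hocolim_diagram (vassiliev_diagram \<A>)"

text \<open>For a chain \<open>c\<close> of faces this is the subdivided closed simplex on its least
  member, the first factor of the cell of \<open>c\<close>.\<close>

definition simplex_part :: "(real^'n) set set set \<Rightarrow> ((real^'n) set set \<Rightarrow> real) set" where
  "simplex_part c = (\<Union>s\<in>order_complex {S \<in> faces. S \<subseteq> (LEAST x. x \<in> c)}. closed_face s)"

lemma shape_cells: "shape cells = order_complex faces"
  by (simp add: hocolim_diagram_def vassiliev_diagram_def)

lemma mor_cells: "mor cells c d v = v"
  by (simp add: hocolim_diagram_def vassiliev_diagram_def map_prod_def case_prod_beta)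

lemma ob_cells: "ob cells c = top_of_set (simplex_part c \<times> \<Inter>(GREATEST x. x \<in> c))"
proof -
  have "finite (order_complex {S \<in> faces. S \<subseteq> (LEAST x. x \<in> c)})"
    by (intro finite_order_complex finite_subset[OF _ finite_nerve_complex]) auto
  then show ?thesis
    unfolding simplex_part_def hocolim_diagram_def vassiliev_diagram_def
    by (simp add: geometric_realization_finite)
qed

lemma compact_simplex_part: "compact (simplex_part c)"
proof -
  have "finite (order_complex {S \<in> faces. S \<subseteq> (LEAST x. x \<in> c)})"
    by (intro finite_order_complex finite_subset[OF _ finite_nerve_complex]) auto
  then show ?thesis
    unfolding simplex_part_def
    by (intro compact_UN compact_closed_face) (auto simp: order_complex_def)
qed

text \<open>Replaces the varying simplex over which weights are summed by the fixed set
  \<open>Pow \<A>\<close>; the sums differ only by zero terms.\<close>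

lemma simplex_part_iff:
  "p \<in> simplex_part c \<longleftrightarrow>
     chain_weight \<A> p \<and> sum p (Pow \<A>) = 1 \<and> (\<forall>S. p S \<noteq> 0 \<longrightarrow> S \<in> faces \<and> S \<subseteq> (LEAST x. x \<in> c))"
  (is "?L \<longleftrightarrow> ?R")
proof -
  have sums: "sum p {S. p S \<noteq> 0} = sum p (Pow \<A>)" if "{S. p S \<noteq> 0} \<subseteq> Pow \<A>"
    using that finite_arrangement by (intro sum.mono_neutral_left) auto
  show ?thesis
  proof
    assume ?L
    then have p: "\<forall>v. 0 \<le> p v" "{v. p v \<noteq> 0} \<in> order_complex {S \<in> faces. S \<subseteq> (LEAST x. x \<in> c)}"
      "sum p {v. p v \<noteq> 0} = 1"
      unfolding simplex_part_def order_complex_faces_iff by auto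
    then have sub: "{v. p v \<noteq> 0} \<subseteq> {S \<in> faces. S \<subseteq> (LEAST x. x \<in> c)}"
      and ch: "Complete_Partial_Order.chain (\<le>) {v. p v \<noteq> 0}"
      by (auto simp: order_complex_def)
    moreover have "{S. p S \<noteq> 0} \<subseteq> Pow \<A> - {{}}"
      using sub nerve_complex_iff by blast
    ultimately show ?R
      using p(1,3) sums by (auto simp: chain_weight_def)
  next
    assume R: ?R
    then have ch: "Complete_Partial_Order.chain (\<le>) {v. p v \<noteq> 0}" and pos: "\<forall>v. 0 \<le> p v"
      and sub: "{S. p S \<noteq> 0} \<subseteq> Pow \<A>"
      by (auto simp: chain_weight_def)
    have "finite {S. p S \<noteq> 0}"
      using sub finite_arrangement by (meson finite_Pow_iff finite_subset)
    moreover have one: "sum p {S. p S \<noteq> 0} = 1"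
      using sums[OF sub] R by simp
    moreover from this have "{S. p S \<noteq> 0} \<noteq> {}"
      by (metis sum.empty zero_neq_one)
    ultimately have "{v. p v \<noteq> 0} \<in> order_complex {S \<in> faces. S \<subseteq> (LEAST x. x \<in> c)}"
      using R ch by (auto simp: order_complex_def)
    then show ?L
      unfolding simplex_part_def order_complex_faces_iff using pos one by blast
  qed
qed

abbreviation "cell_sum \<equiv> sum_topology (ob cells) (shape cells)"

lemma topspace_cell_sum:
  "(c, p, x) \<in> topspace cell_sum \<longleftrightarrow>
     c \<in> order_complex faces \<and> p \<in> simplex_part c \<and> x \<in> \<Inter>(GREATEST x. x \<in> c)"
  by (simp add: shape_cells ob_cells)

lemma order_complex_extrema:
  assumes "c \<in> order_complex faces"
  shows "(LEAST x. x \<in> c) \<in> c" "(GREATEST x. x \<in> c) \<in> c"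
    "\<And>S. S \<in> c \<Longrightarrow> (LEAST x. x \<in> c) \<subseteq> S" "\<And>S. S \<in> c \<Longrightarrow> S \<subseteq> (GREATEST x. x \<in> c)"
    "(LEAST x. x \<in> c) \<subseteq> (GREATEST x. x \<in> c)"
  using assms finite_chain_Least[of c] finite_chain_Greatest[of c] unfolding order_complex_def
  by auto

text \<open>The chain supporting \<open>p\<close> lies below the least, hence below the greatest
  member of \<open>c\<close>, and taking intersections reverses inclusion.\<close>

lemma resolution_pair_of_cell:
  assumes "c \<in> order_complex faces" "p \<in> simplex_part c" "x \<in> \<Inter>(GREATEST x. x \<in> c)"
  shows "resolution_pair p x"
  using assms order_complex_extrema(5)[OF assms(1)] unfolding simplex_part_iff resolution_pair_def by blast

lemma glue_cells:
  assumes "(c, v) \<in> topspace cell_sum" "d \<in> order_complex faces" "d \<subseteq> c"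
  shows "glue cells (c, v) (d, v)"
  using glue.intros[of c cells d v] assms by (simp add: shape_cells mor_cells)

section \<open>Gluing of cells\<close>

text \<open>A normal form: \<open>T\<close> depends on \<open>p\<close> alone, so any two triples
  with the same \<open>p\<close> and \<open>x\<close> are glued to the same one.\<close>

lemma equivclp_top:
  assumes cell: "(c, p, x) \<in> topspace cell_sum" and T: "p T \<noteq> 0" "\<And>S. p S \<noteq> 0 \<Longrightarrow> S \<subseteq> T"
  shows "equivclp (glue cells) (c, p, x) ({T}, p, x)"
proof -
  have c: "c \<in> order_complex faces" and p: "p \<in> simplex_part c" and x: "x \<in> \<Inter>(GREATEST x. x \<in> c)"
    using cell by (simp_all only: topspace_cell_sum)
  note c' = c[unfolded order_complex_def]
  have TN: "T \<in> faces" and Tc: "T \<subseteq> (LEAST x. x \<in> c)"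
    using p T(1) by (auto simp: simplex_part_iff)
  have below: "T \<subseteq> S" if "S \<in> c" for S
    using Tc order_complex_extrema(3)[OF c that] by blast
  \<comment> \<open>Both cells are glued to that of the chain obtained by adding \<open>T\<close> at the bottom of \<open>c\<close>.\<close>
  let ?d = "insert T c"
  have d: "?d \<in> order_complex faces" and T': "{T} \<in> order_complex faces"
    using c' TN below by (auto simp: order_complex_def chain_def)
  have "(LEAST x. x \<in> ?d) = T"
    using below by (intro Least_equality) auto
  moreover have "(GREATEST x. x \<in> ?d) = (GREATEST x. x \<in> c)"
    using order_complex_extrema[OF c] Tc by (intro Greatest_equality) auto
  ultimately have cell': "(?d, p, x) \<in> topspace cell_sum"
    using d p x T(2) unfolding topspace_cell_sum simplex_part_iff by simp
  have "glue cells (?d, p, x) (c, p, x)" "glue cells (?d, p, x) ({T}, p, x)"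
    using glue_cells[OF cell'] c T' by auto
  then show ?thesis
    by (meson equivclp_sym equivclp_trans r_into_equivclp)
qed

definition resolution_map where "resolution_map = (\<lambda>(c :: (real^'n) set set set, p, x). resolution_point p x)"

text \<open>Gluing changes only the chain, which \<open>resolution_map\<close> ignores. Conversely,
  equal images force equal \<open>p\<close> and \<open>x\<close>, and then both triples have the
  same normal form.\<close>

lemma glue_class_iff:
  assumes a: "a \<in> topspace cell_sum" and b: "b \<in> topspace cell_sum"
  shows "equivclp (glue cells) a b \<longleftrightarrow> resolution_map a = resolution_map b"
proof
  assume "equivclp (glue cells) a b"
  then have "snd a = snd b"
    by (rule equivclp_glue_snd) (rule mor_cells)
  then show "resolution_map a = resolution_map b"
    by (simp add: resolution_map_def case_prod_beta)
next
  assume eq: "resolution_map a = resolution_map b"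
  obtain c p x d q y where ab: "a = (c, p, x)" "b = (d, q, y)"
    by (metis prod.exhaust)
  have v: "resolution_pair p x" "resolution_pair q y"
    using a b resolution_pair_of_cell unfolding ab topspace_cell_sum by blast+
  have pq: "q = p" "y = x"
    using resolution_point_inj[OF v] eq unfolding ab resolution_map_def by auto
  obtain T where T: "p T \<noteq> 0" "\<And>S. p S \<noteq> 0 \<Longrightarrow> S \<subseteq> T"
    using resolution_pair_top[OF v(1)] by blast
  show "equivclp (glue cells) a b"
    using equivclp_top[OF a[unfolded ab] T] equivclp_top[OF b[unfolded ab pq] T]
    unfolding ab pq by (meson equivclp_sym equivclp_trans)
qed

lemma image_resolution_map: "resolution_map ` topspace cell_sum = geometric_resolution \<A> \<phi>"
proof
  show "resolution_map ` topspace cell_sum \<subseteq> geometric_resolution \<A> \<phi>"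
  proof (clarify, unfold topspace_cell_sum)
    fix c p x assume "c \<in> order_complex faces \<and> p \<in> simplex_part c \<and> x \<in> \<Inter>(GREATEST x. x \<in> c)"
    then have "resolution_pair p x"
      using resolution_pair_of_cell by blast
    then show "resolution_map (c, p, x) \<in> geometric_resolution \<A> \<phi>"
      using UN_I[OF resolution_pair_in_arrangement resolution_point_in_fibre] unfolding geometric_resolution_def resolution_map_def by simp
  qed
  show "geometric_resolution \<A> \<phi> \<subseteq> resolution_map ` topspace cell_sum"
  proof
    fix y assume "y \<in> geometric_resolution \<A> \<phi>"
    then obtain p x where v: "resolution_pair p x" "resolution_point p x = y"
      using resolution_point_surj by blast
    obtain T where T: "p T \<noteq> 0" "\<And>S. p S \<noteq> 0 \<Longrightarrow> S \<subseteq> T"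
      using resolution_pair_top[OF v(1)] by blast
    have p: "chain_weight \<A> p" "sum p (Pow \<A>) = 1" and x: "\<And>S. p S \<noteq> 0 \<Longrightarrow> x \<in> \<Inter>S"
      using v(1) by (auto simp: resolution_pair_def)
    have faces: "S \<in> faces" if "p S \<noteq> 0" for S
      using chain_weight_subset[OF p(1) that] chain_weight_nonempty[OF p(1) that] x[OF that]
      unfolding nerve_complex_iff by blast
    have "(LEAST x. x \<in> {T}) = T" "(GREATEST x. x \<in> {T}) = T"
      by (rule Least_equality Greatest_equality; simp)+
    \<comment> \<open>The normal form serves as the preimage.\<close>
    then have "({T}, p, x) \<in> topspace cell_sum"
      unfolding topspace_cell_sum simplex_part_iff using p faces T x[OF T(1)]
      by (auto simp: order_complex_def chain_def)
    moreover have "resolution_map ({T}, p, x) = y"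
      using v(2) by (simp add: resolution_map_def)
    ultimately show "y \<in> resolution_map ` topspace cell_sum"
      by blast
  qed
qed

section \<open>The resolution as a quotient of the cells\<close>

lemma resolution_map_on_cell:
  assumes c: "c \<in> order_complex faces"
  shows "continuous_map (ob cells c) euclidean (\<lambda>v. resolution_map (c, v))"
    and "closed_map (ob cells c) euclidean (\<lambda>v. resolution_map (c, v))"
proof -
  define M where "M = (GREATEST x. x \<in> c)"
  have "M \<in> faces"
    using order_complex_extrema(2)[OF c] c unfolding M_def order_complex_def by blast
  then have M: "M \<subseteq> \<A>"
    by (simp add: nerve_complex_iff)
  have K: "compact (simplex_part c)"
    by (rule compact_simplex_part)
  have B: "affine (\<Inter>M)"
    using M arrangement by (intro affine_Inter) (auto simp: affine_arrangement_def)
  have f: "affine_on (\<Inter>M) (\<phi> A)" if "A \<in> M" for A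
  proof -
    have "affine_on A (\<phi> A)"
      using that M embeddings by (auto simp: resolution_embeddings_def)
    then show ?thesis
      by (rule affine_on_subset) (use that in blast)
  qed
  have t: "continuous_on (simplex_part c) (\<lambda>p. bary \<A> p A)" for A
    by (rule continuous_on_bary)
  \<comment> \<open>The sum is cut down to \<open>M\<close> because each \<open>\<phi> A\<close> is
    known to be affine only on \<open>A\<close>, and the members of \<open>M\<close> share the
    domain \<open>\<Inter>M\<close>.\<close>
  have map_eq: "resolution_map (c, p, x) = (\<Sum>A\<in>M. bary \<A> p A *\<^sub>R \<phi> A x)" if "p \<in> simplex_part c" for p x
  proof -
    have "bary \<A> p A = 0" if "A \<notin> M" for A
    proof (rule ccontr)
      assume "bary \<A> p A \<noteq> 0"
      then obtain S where "p S \<noteq> 0" "A \<in> S"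
        using bary_pos_iff[OF finite_arrangement] \<open>p \<in> simplex_part c\<close> unfolding simplex_part_iff by blast
      then show False
        using \<open>p \<in> simplex_part c\<close> \<open>A \<notin> M\<close> order_complex_extrema(5)[OF c]
        unfolding simplex_part_iff M_def by blast
    qed
    then show ?thesis
      unfolding resolution_map_def resolution_point_def using M finite_arrangement
      by simp (intro sum.mono_neutral_right; auto)
  qed
  \<comment> \<open>Injectivity for fixed \<open>p\<close>, needed for properness, is a special case
    of the global injectivity.\<close>
  have inj: "inj_on (\<lambda>x. \<Sum>A\<in>M. bary \<A> p A *\<^sub>R \<phi> A x) (\<Inter>M)" if p: "p \<in> simplex_part c" for p
  proof (rule inj_onI)
    fix x y assume xy: "x \<in> \<Inter>M" "y \<in> \<Inter>M"
      and eq: "(\<Sum>A\<in>M. bary \<A> p A *\<^sub>R \<phi> A x) = (\<Sum>A\<in>M. bary \<A> p A *\<^sub>R \<phi> A y)"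
    have "resolution_point p x = resolution_point p y"
      using eq map_eq[OF p] unfolding resolution_map_def by simp
    then show "x = y"
      using resolution_point_inj(2) resolution_pair_of_cell[OF c p] xy unfolding M_def by blast
  qed
  have obc: "ob cells c = top_of_set (simplex_part c \<times> \<Inter>M)"
    unfolding ob_cells M_def ..
  let ?g = "\<lambda>(p, x). \<Sum>A\<in>M. bary \<A> p A *\<^sub>R \<phi> A x"
  have Gg: "resolution_map (c, v) = ?g v" if "v \<in> simplex_part c \<times> \<Inter>M" for v
    using that map_eq by (cases v) auto
  have "continuous_on (simplex_part c \<times> \<Inter>M) ?g"
    unfolding case_prod_beta
    by (rule continuous_on_affine_family[OF t B f continuous_on_fst[OF continuous_on_id]
          continuous_on_snd[OF continuous_on_id]]) auto
  then have "continuous_on (simplex_part c \<times> \<Inter>M) (\<lambda>v. resolution_map (c, v))"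
    by (rule continuous_on_eq) (simp add: Gg)
  then show "continuous_map (ob cells c) euclidean (\<lambda>v. resolution_map (c, v))"
    unfolding obc by simp
  show "closed_map (ob cells c) euclidean (\<lambda>v. resolution_map (c, v))"
    unfolding closed_map_def obc
  proof (intro allI impI)
    fix C assume C: "closedin (top_of_set (simplex_part c \<times> \<Inter>M)) C"
    then have "C \<subseteq> simplex_part c \<times> \<Inter>M"
      by (rule closedin_imp_subset)
    then have "(\<lambda>v. resolution_map (c, v)) ` C = ?g ` C"
      using Gg by (intro image_cong) auto
    moreover have "closed (?g ` C)"
      by (rule closed_affine_family_image[OF K t B f inj C])
    ultimately show "closedin euclidean ((\<lambda>v. resolution_map (c, v)) ` C)"
      by simp
  qed
qed

text \<open>A continuous closed surjection is a quotient map; closedness passes from the cells to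
  their sum because there are finitely many.\<close>

lemma quotient_map_resolution_map: "quotient_map cell_sum (top_of_set (geometric_resolution \<A> \<phi>)) resolution_map"
proof (rule continuous_closed_imp_quotient_map)
  have fin: "finite (shape cells)"
    unfolding shape_cells by (intro finite_order_complex finite_nerve_complex)
  have "continuous_map cell_sum euclidean resolution_map"
    by (rule continuous_map_from_sum_topology) (simp add: resolution_map_on_cell shape_cells)
  then show "continuous_map cell_sum (top_of_set (geometric_resolution \<A> \<phi>)) resolution_map"
    using image_resolution_map by (auto simp: continuous_map_in_subtopology)
  have "closed_map cell_sum euclidean resolution_map"
    by (rule closed_map_from_sum_topology[OF fin]) (simp add: resolution_map_on_cell shape_cells)
  then show "closed_map cell_sum (top_of_set (geometric_resolution \<A> \<phi>)) resolution_map"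
    using image_resolution_map by (intro closed_map_into_subtopology) auto
qed (simp only: image_resolution_map topspace_euclidean_subtopology)

lemma hocolim_homeomorphic_resolution:
  "hocolim (vassiliev_diagram \<A>) homeomorphic_space top_of_set (geometric_resolution \<A> \<phi>)"
proof -
  define R where "R = {(a, b). a \<in> topspace cell_sum \<and> b \<in> topspace cell_sum \<and> equivclp (glue cells) a b}"
  have eq: "hocolim (vassiliev_diagram \<A>) = quotient_topology cell_sum R"
    by (simp add: hocolim_def colim_def R_def Let_def)
  have R: "(a, b) \<in> R \<longleftrightarrow> a \<in> topspace cell_sum \<and> b \<in> topspace cell_sum \<and> resolution_map a = resolution_map b" for a b
    using glue_class_iff unfolding R_def by blast
  \<comment> \<open>The gluing classes are exactly the fibres of \<open>resolution_map\<close>, so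
    both spaces are quotients of \<open>cell_sum\<close> by the same relation.\<close>
  have cls: "R `` {a} = {b \<in> topspace cell_sum. resolution_map a = resolution_map b}" if "a \<in> topspace cell_sum" for a
    using that R unfolding Image_singleton by blast
  have "R `` {a} = R `` {b} \<longleftrightarrow> resolution_map a = resolution_map b" if "a \<in> topspace cell_sum" "b \<in> topspace cell_sum" for a b
    unfolding cls[OF that(1)] cls[OF that(2)] using that(2) by auto
  then show ?thesis
    unfolding eq
    by (intro quotient_maps_same_fibres_imp_homeomorphic_space[OF quotient_map_quotient_topology quotient_map_resolution_map])
qed

end

theorem theorem3p9:
  fixes \<A> :: "(real^'n) set set"
    and \<phi> :: "(real^'n) set \<Rightarrow> real^'n \<Rightarrow> real^'m"
  assumes "affine_arrangement \<A>"
    and "resolution_embeddings \<A> \<phi>"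
  shows "Alexandroff_compactification (hocolim (vassiliev_diagram \<A>))
           homeomorphic_space
         Alexandroff_compactification (top_of_set (geometric_resolution \<A> \<phi>))"
proof -
  interpret resolved_arrangement \<A> \<phi>
    by unfold_locales fact+
  show ?thesis
    by (rule homeomorphic_space_Alexandroff_compactification[OF hocolim_homeomorphic_resolution])
qed

end
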